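(* Let $H=\{H_\alpha\}_{\alpha\in\pi}$ be a Hopf $\pi$-coalgebra with every $H_\alpha$ finite dimensional, $\dim H_\alpha=n^\alpha$, let $(C,\sigma)$ be a left $\pi$-coisotropic quantum subgroup of $H$, and let $V=\{V_\alpha\}_{\alpha\in\pi}$ be a left $\pi$-comodule over $C$ by $\rho=\{\rho_{\alpha,\beta}:V_{\alpha\beta}\to C_\alpha\otimes V_\beta\}_{\alpha,\beta\in\pi}$. Let $$W_\alpha=\{F\in \mathrm{Hom}_K(V_1,H_\alpha):\ L_{1,\alpha}F=(I_{C_1}\otimes F)\rho_{1,1}\},\qquad L_{1,\alpha}=(\sigma_1\otimes I_\alpha)\Delta^H_{1,\alpha}.$$ For each $\beta\in\pi$ let $\{e_i^\beta\}_{i=1}^{n^\beta}$ be a basis of $H_\beta$ with dual basis $\{g_i^\beta\}_{i=1}^{n^\beta}$ of $H_\beta^*$. Then $W=\{W_\alpha\}_{\alpha\in\pi}$ is a right $\pi$-comodule over $H$ by $\Omega=\{\Omega_{\alpha,\beta}\}_{\alpha,\beta\in\pi}$, where $$\Omega_{\alpha,\beta}:W_{\alpha\beta}\to W_\alpha\otimes H_\beta,\qquad \Omega_{\alpha,\beta}(F)=\sum_{i=1}^{n^\beta}\big(\sim(I_\alpha\otimes g_i^\beta)\Delta^H_{\alpha,\beta}F\big)\otimes e_i^\beta,$$ and $\sim:H_\alpha\otimes K\to H_\alpha$ is the canonical isomorphism.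
   Context: $K$ is a field; all spaces, maps and tensor products are over $K$; $\pi$ is a group with unit $1$; $I_\alpha$ denotes the identity map of the $\alpha$-component of the relevant family. A $\pi$-coalgebra is a family $C=\{C_\alpha\}_{\alpha\in\pi}$ of $K$-spaces with linear maps $\Delta_{\alpha,\beta}:C_{\alpha\beta}\to C_\alpha\otimes C_\beta$ and $\varepsilon:C_1\to K$ such that $(\Delta_{\alpha,\beta}\otimes I_\gamma)\Delta_{\alpha\beta,\gamma}=(I_\alpha\otimes\Delta_{\beta,\gamma})\Delta_{\alpha,\beta\gamma}$ and, up to the canonical identifications $K\otimes C_\alpha\cong C_\alpha\cong C_\alpha\otimes K$, $(\varepsilon\otimes I_\alpha)\Delta_{1,\alpha}=I_\alpha=(I_\alpha\otimes\varepsilon)\Delta_{\alpha,1}$. A Hopf $\pi$-coalgebra is a $\pi$-coalgebra $H=\{H_\alpha\}$ in which each $H_\alpha$ is an associative unital algebra (multiplication $\mu_\alpha$, unit $1_\alpha$), all $\Delta_{\alpha,\beta}$ and $\varepsilon$ are algebra maps, together with linear maps $S_\alpha:H_\alpha\to H_{\alpha^{-1}}$ such that $\mu_\alpha(S_{\alpha^{-1}}\otimes I_\alpha)\Delta_{\alpha^{-1},\alpha}=1_\alpha\varepsilon=\mu_\alpha(I_\alpha\otimes S_{\alpha^{-1}})\Delta_{\alpha,\alpha^{-1}}$. A left $\pi$-coisotropic quantum subgroup of $H$ is a pair $(C,\sigma)$ where $C$ is a $\pi$-coalgebra, each $C_\alpha$ is a left $H_\alpha$-module by $\omega_\alpha:H_\alpha\otimes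 C_\alpha\to C_\alpha$, and $\sigma=\{\sigma_\alpha:H_\alpha\to C_\alpha\}$ is a family of surjective linear maps such that each $\sigma_\alpha$ is a left $H_\alpha$-module map, $\Delta^C_{\alpha,\beta}\sigma_{\alpha\beta}=(\sigma_\alpha\otimes\sigma_\beta)\Delta^H_{\alpha,\beta}$, and $\varepsilon^C\sigma_1=\varepsilon^H$. A right $\pi$-comodule over a $\pi$-coalgebra $C$ is a family $M=\{M_\alpha\}$ of $K$-spaces with linear maps $\theta_{\alpha,\beta}:M_{\alpha\beta}\to M_\alpha\otimes C_\beta$ such that $(\theta_{\alpha,\beta}\otimes I_\gamma)\theta_{\alpha\beta,\gamma}=(I_\alpha\otimes\Delta_{\beta,\gamma})\theta_{\alpha,\beta\gamma}$ and $(I_\alpha\otimes\varepsilon)\theta_{\alpha,1}$ is the canonical map $M_\alpha\to M_\alpha\otimes K$. A left $\pi$-comodule over $C$ is defined symmetrically: linear maps $\rho_{\alpha,\beta}:V_{\alpha\beta}\to C_\alpha\otimes V_\beta$ with $(I_\alpha\otimes\rho_{\beta,\gamma})\rho_{\alpha,\beta\gamma}=(\Delta_{\alpha,\beta}\otimes I_\gamma)\rho_{\alpha\beta,\gamma}$ and $(\varepsilon\otimes I_\alpha)\rho_{1,\alpha}$ the canonical map $V_\alpha\to K\otimes V_\alpha$. *)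

theory Defs
  imports "HOL-Algebra.AbelCoset" "Jordan_Normal_Form.Missing_VectorSpace"
begin

section \<open>Tensor products of vector spaces\<close>

text \<open>
  All spaces are HOL-Algebra module records over a field \<open>K\<close>, so the members of a family
  indexed by a group share one element type but have independent carriers and operations.
  The tensor product is the free space on \<open>carrier A \<times> carrier B\<close> (finitely supported
  functions) modulo the bilinearity relators; its elements are cosets.
\<close>

type_synonym ('k, 'a, 'b) tensor = "('a \<times> 'b \<Rightarrow> 'k) set"

definition ground_space :: "'k ring \<Rightarrow> ('k, 'k) module" where
  "ground_space K = \<lparr>carrier = carrier K, mult = mult K, one = one K, zero = zero K,
     add = add K, smult = mult K\<rparr>"

definition free_space :: "'k ring \<Rightarrow> 'x set \<Rightarrow> ('k, 'x \<Rightarrow> 'k) module" where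
  "free_space K X = (ring.func_space K X)
     \<lparr>carrier := {f \<in> X \<rightarrow>\<^sub>E carrier K. finite {x \<in> X. f x \<noteq> \<zero>\<^bsub>K\<^esub>}}\<rparr>"

definition free_gen :: "'k ring \<Rightarrow> 'x set \<Rightarrow> 'x \<Rightarrow> 'x \<Rightarrow> 'k" where
  "free_gen K X x = (\<lambda>y\<in>X. if y = x then \<one>\<^bsub>K\<^esub> else \<zero>\<^bsub>K\<^esub>)"

definition tensor_relators ::
  "'k ring \<Rightarrow> ('k, 'a) module \<Rightarrow> ('k, 'b) module \<Rightarrow> ('a \<times> 'b \<Rightarrow> 'k) set" where
  "tensor_relators K A B =
    (let X = carrier A \<times> carrier B; F = free_space K X; d = (\<lambda>a b. free_gen K X (a, b)) in
      {d (a \<oplus>\<^bsub>A\<^esub> a') b \<ominus>\<^bsub>F\<^esub> (d a b \<oplus>\<^bsub>F\<^esub> d a' b) | a a' b.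
          a \<in> carrier A \<and> a' \<in> carrier A \<and> b \<in> carrier B}
    \<union> {d a (b \<oplus>\<^bsub>B\<^esub> b') \<ominus>\<^bsub>F\<^esub> (d a b \<oplus>\<^bsub>F\<^esub> d a b') | a b b'.
          a \<in> carrier A \<and> b \<in> carrier B \<and> b' \<in> carrier B}
    \<union> {d (k \<odot>\<^bsub>A\<^esub> a) b \<ominus>\<^bsub>F\<^esub> k \<odot>\<^bsub>F\<^esub> d a b | k a b.
          k \<in> carrier K \<and> a \<in> carrier A \<and> b \<in> carrier B}
    \<union> {d a (k \<odot>\<^bsub>B\<^esub> b) \<ominus>\<^bsub>F\<^esub> k \<odot>\<^bsub>F\<^esub> d a b | k a b.
          k \<in> carrier K \<and> a \<in> carrier A \<and> b \<in> carrier B})"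

definition tensor_null ::
  "'k ring \<Rightarrow> ('k, 'a) module \<Rightarrow> ('k, 'b) module \<Rightarrow> ('k, 'a, 'b) tensor" where
  "tensor_null K A B =
     module.span K (free_space K (carrier A \<times> carrier B)) (tensor_relators K A B)"

definition tensor_space ::
  "'k ring \<Rightarrow> ('k, 'a) module \<Rightarrow> ('k, 'b) module \<Rightarrow> ('k, ('k, 'a, 'b) tensor) module" where
  "tensor_space K A B =
    (let F = free_space K (carrier A \<times> carrier B); N = tensor_null K A B in
      \<lparr>carrier = a_rcosets\<^bsub>F\<^esub> N, mult = undefined, one = undefined, zero = N,
       add = set_add F, smult = (\<lambda>k X. \<Union>f\<in>X. N +>\<^bsub>F\<^esub> (k \<odot>\<^bsub>F\<^esub> f))\<rparr>)"

definition pure_tensor ::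
  "'k ring \<Rightarrow> ('k, 'a) module \<Rightarrow> ('k, 'b) module \<Rightarrow> 'a \<Rightarrow> 'b \<Rightarrow> ('k, 'a, 'b) tensor" where
  "pure_tensor K A B a b =
    (let X = carrier A \<times> carrier B in
      tensor_null K A B +>\<^bsub>free_space K X\<^esub> free_gen K X (a, b))"

text \<open>
  For bilinear \<open>\<phi>\<close>, the linear map on \<open>A \<otimes> B\<close> with \<open>a \<otimes> b \<mapsto> \<phi> a b\<close>: the linear
  extension of \<open>\<phi>\<close> takes a single value on each coset.
\<close>

definition tensor_lift ::
  "'k ring \<Rightarrow> ('k, 'a) module \<Rightarrow> ('k, 'b) module \<Rightarrow> ('k, 'c) module \<Rightarrow>
   ('a \<Rightarrow> 'b \<Rightarrow> 'c) \<Rightarrow> ('k, 'a, 'b) tensor \<Rightarrow> 'c" where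
  "tensor_lift K A B D \<phi> X = the_elem
    ((\<lambda>f. \<Oplus>\<^bsub>D\<^esub>p\<in>{p \<in> carrier A \<times> carrier B. f p \<noteq> \<zero>\<^bsub>K\<^esub>}. f p \<odot>\<^bsub>D\<^esub> \<phi> (fst p) (snd p)) ` X)"

definition tensor_map ::
  "'k ring \<Rightarrow> ('k, 'a) module \<Rightarrow> ('k, 'b) module \<Rightarrow> ('k, 'c) module \<Rightarrow> ('k, 'd) module \<Rightarrow>
   ('a \<Rightarrow> 'c) \<Rightarrow> ('b \<Rightarrow> 'd) \<Rightarrow> ('k, 'a, 'b) tensor \<Rightarrow> ('k, 'c, 'd) tensor" where
  "tensor_map K A B C D f g =
     tensor_lift K A B (tensor_space K C D) (\<lambda>a b. pure_tensor K C D (f a) (g b))"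

text \<open>The canonical maps
  \<open>(A \<otimes> B) \<otimes> C \<rightarrow> A \<otimes> (B \<otimes> C)\<close>, \<open>K \<otimes> A \<rightarrow> A\<close> and \<open>A \<otimes> K \<rightarrow> A\<close>.\<close>

definition tensor_assoc ::
  "'k ring \<Rightarrow> ('k, 'a) module \<Rightarrow> ('k, 'b) module \<Rightarrow> ('k, 'c) module \<Rightarrow>
   ('k, ('k, 'a, 'b) tensor, 'c) tensor \<Rightarrow> ('k, 'a, ('k, 'b, 'c) tensor) tensor" where
  "tensor_assoc K A B C =
    (let BC = tensor_space K B C; T = tensor_space K A BC in
      tensor_lift K (tensor_space K A B) C T
        (\<lambda>t c. tensor_lift K A B T (\<lambda>a b. pure_tensor K A BC a (pure_tensor K B C b c)) t))"

definition tensor_lunit ::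
  "'k ring \<Rightarrow> ('k, 'a) module \<Rightarrow> ('k, 'k, 'a) tensor \<Rightarrow> 'a" where
  "tensor_lunit K A = tensor_lift K (ground_space K) A A (\<lambda>k a. k \<odot>\<^bsub>A\<^esub> a)"

definition tensor_runit ::
  "'k ring \<Rightarrow> ('k, 'a) module \<Rightarrow> ('k, 'a, 'k) tensor \<Rightarrow> 'a" where
  "tensor_runit K A = tensor_lift K A (ground_space K) A (\<lambda>a k. k \<odot>\<^bsub>A\<^esub> a)"

section \<open>Algebras and modules over them\<close>

text \<open>The library's \<^locale>\<open>algebra\<close> is commutative, hence this variant.\<close>

locale unital_algebra = vectorspace K A + ring A
  for K :: "'k ring" and A :: "('k, 'a) module" +
  assumes smult_mult_left: "\<lbrakk>k \<in> carrier K; a \<in> carrier A; b \<in> carrier A\<rbrakk> \<Longrightarrow>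
      (k \<odot>\<^bsub>A\<^esub> a) \<otimes>\<^bsub>A\<^esub> b = k \<odot>\<^bsub>A\<^esub> (a \<otimes>\<^bsub>A\<^esub> b)"
    and smult_mult_right: "\<lbrakk>k \<in> carrier K; a \<in> carrier A; b \<in> carrier A\<rbrakk> \<Longrightarrow>
      a \<otimes>\<^bsub>A\<^esub> (k \<odot>\<^bsub>A\<^esub> b) = k \<odot>\<^bsub>A\<^esub> (a \<otimes>\<^bsub>A\<^esub> b)"

definition mult_map :: "'k ring \<Rightarrow> ('k, 'a) module \<Rightarrow> ('k, 'a, 'a) tensor \<Rightarrow> 'a" where
  "mult_map K A = tensor_lift K A A A (mult A)"

text \<open>The multiplication is \<open>(a \<otimes> b)(c \<otimes> d) = ac \<otimes> bd\<close>.\<close>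

definition tensor_algebra ::
  "'k ring \<Rightarrow> ('k, 'a) module \<Rightarrow> ('k, 'b) module \<Rightarrow> ('k, ('k, 'a, 'b) tensor) module" where
  "tensor_algebra K A B =
    (let T = tensor_space K A B in
      T\<lparr>mult := (\<lambda>X Y. tensor_lift K A B T (\<lambda>a b. tensor_lift K A B T
              (\<lambda>c d. pure_tensor K A B (a \<otimes>\<^bsub>A\<^esub> c) (b \<otimes>\<^bsub>B\<^esub> d)) Y) X),
        one := pure_tensor K A B \<one>\<^bsub>A\<^esub> \<one>\<^bsub>B\<^esub>\<rparr>)"

locale left_algebra_module = unital_algebra K A + action?: linear_map K "tensor_space K A M" M \<omega>
  for K :: "'k ring" and A :: "('k, 'a) module" and M :: "('k, 'm) module"
    and \<omega> :: "('k, 'a, 'm) tensor \<Rightarrow> 'm" +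
  assumes action_mult: "\<lbrakk>a \<in> carrier A; b \<in> carrier A; x \<in> carrier M\<rbrakk> \<Longrightarrow>
      \<omega> (pure_tensor K A M (a \<otimes>\<^bsub>A\<^esub> b) x) =
      \<omega> (pure_tensor K A M a (\<omega> (pure_tensor K A M b x)))"
    and action_one: "x \<in> carrier M \<Longrightarrow> \<omega> (pure_tensor K A M \<one>\<^bsub>A\<^esub> x) = x"

section \<open>\<open>\<pi>\<close>-coalgebras, comodules and coisotropic quantum subgroups\<close>

locale pi_coalgebra = field K + group G
  for K :: "'k ring" and G :: "'p monoid" (structure) +
  fixes C :: "'p \<Rightarrow> ('k, 'c) module"
    and \<Delta> :: "'p \<Rightarrow> 'p \<Rightarrow> 'c \<Rightarrow> ('k, 'c, 'c) tensor"
    and \<epsilon> :: "'c \<Rightarrow> 'k"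
  assumes component_space: "\<alpha> \<in> carrier G \<Longrightarrow> vectorspace K (C \<alpha>)"
    and comult_linear: "\<lbrakk>\<alpha> \<in> carrier G; \<beta> \<in> carrier G\<rbrakk> \<Longrightarrow>
      linear_map K (C (\<alpha> \<otimes> \<beta>)) (tensor_space K (C \<alpha>) (C \<beta>)) (\<Delta> \<alpha> \<beta>)"
    and counit_linear: "linear_map K (C \<one>) (ground_space K) \<epsilon>"
    and coassoc: "\<lbrakk>\<alpha> \<in> carrier G; \<beta> \<in> carrier G; \<gamma> \<in> carrier G;
        x \<in> carrier (C (\<alpha> \<otimes> \<beta> \<otimes> \<gamma>))\<rbrakk> \<Longrightarrow>
      tensor_assoc K (C \<alpha>) (C \<beta>) (C \<gamma>)
        (tensor_map K (C (\<alpha> \<otimes> \<beta>)) (C \<gamma>) (tensor_space K (C \<alpha>) (C \<beta>)) (C \<gamma>)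
          (\<Delta> \<alpha> \<beta>) id (\<Delta> (\<alpha> \<otimes> \<beta>) \<gamma> x)) =
      tensor_map K (C \<alpha>) (C (\<beta> \<otimes> \<gamma>)) (C \<alpha>) (tensor_space K (C \<beta>) (C \<gamma>))
          id (\<Delta> \<beta> \<gamma>) (\<Delta> \<alpha> (\<beta> \<otimes> \<gamma>) x)"
    and counit_left: "\<lbrakk>\<alpha> \<in> carrier G; x \<in> carrier (C \<alpha>)\<rbrakk> \<Longrightarrow>
      tensor_lunit K (C \<alpha>)
        (tensor_map K (C \<one>) (C \<alpha>) (ground_space K) (C \<alpha>) \<epsilon> id (\<Delta> \<one> \<alpha> x)) = x"
    and counit_right: "\<lbrakk>\<alpha> \<in> carrier G; x \<in> carrier (C \<alpha>)\<rbrakk> \<Longrightarrow>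
      tensor_runit K (C \<alpha>)
        (tensor_map K (C \<alpha>) (C \<one>) (C \<alpha>) (ground_space K) id \<epsilon> (\<Delta> \<alpha> \<one> x)) = x"

locale hopf_pi_coalgebra = pi_coalgebra K G H \<Delta> \<epsilon>
  for K :: "'k ring" and G :: "'p monoid" (structure)
    and H :: "'p \<Rightarrow> ('k, 'h) module"
    and \<Delta> :: "'p \<Rightarrow> 'p \<Rightarrow> 'h \<Rightarrow> ('k, 'h, 'h) tensor"
    and \<epsilon> :: "'h \<Rightarrow> 'k" +
  fixes S :: "'p \<Rightarrow> 'h \<Rightarrow> 'h"
  assumes component_algebra: "\<alpha> \<in> carrier G \<Longrightarrow> unital_algebra K (H \<alpha>)"
    and comult_ring_hom: "\<lbrakk>\<alpha> \<in> carrier G; \<beta> \<in> carrier G\<rbrakk> \<Longrightarrow>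
      \<Delta> \<alpha> \<beta> \<in> ring_hom (H (\<alpha> \<otimes> \<beta>)) (tensor_algebra K (H \<alpha>) (H \<beta>))"
    and counit_ring_hom: "\<epsilon> \<in> ring_hom (H \<one>) (ground_space K)"
    and antipode_linear: "\<alpha> \<in> carrier G \<Longrightarrow> linear_map K (H \<alpha>) (H (inv \<alpha>)) (S \<alpha>)"
    and antipode_left: "\<lbrakk>\<alpha> \<in> carrier G; x \<in> carrier (H \<one>)\<rbrakk> \<Longrightarrow>
      mult_map K (H \<alpha>)
        (tensor_map K (H (inv \<alpha>)) (H \<alpha>) (H \<alpha>) (H \<alpha>) (S (inv \<alpha>)) id (\<Delta> (inv \<alpha>) \<alpha> x)) =
      \<epsilon> x \<odot>\<^bsub>H \<alpha>\<^esub> \<one>\<^bsub>H \<alpha>\<^esub>"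
    and antipode_right: "\<lbrakk>\<alpha> \<in> carrier G; x \<in> carrier (H \<one>)\<rbrakk> \<Longrightarrow>
      mult_map K (H \<alpha>)
        (tensor_map K (H \<alpha>) (H (inv \<alpha>)) (H \<alpha>) (H \<alpha>) id (S (inv \<alpha>)) (\<Delta> \<alpha> (inv \<alpha>) x)) =
      \<epsilon> x \<odot>\<^bsub>H \<alpha>\<^esub> \<one>\<^bsub>H \<alpha>\<^esub>"

locale left_coisotropic_subgroup =
    hopf: hopf_pi_coalgebra K G H \<Delta>H \<epsilon>H S + coalg: pi_coalgebra K G C \<Delta>C \<epsilon>C
  for K :: "'k ring" and G :: "'p monoid" (structure)
    and H :: "'p \<Rightarrow> ('k, 'h) module"
    and \<Delta>H :: "'p \<Rightarrow> 'p \<Rightarrow> 'h \<Rightarrow> ('k, 'h, 'h) tensor"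
    and \<epsilon>H :: "'h \<Rightarrow> 'k"
    and S :: "'p \<Rightarrow> 'h \<Rightarrow> 'h"
    and C :: "'p \<Rightarrow> ('k, 'c) module"
    and \<Delta>C :: "'p \<Rightarrow> 'p \<Rightarrow> 'c \<Rightarrow> ('k, 'c, 'c) tensor"
    and \<epsilon>C :: "'c \<Rightarrow> 'k" +
  fixes \<omega> :: "'p \<Rightarrow> ('k, 'h, 'c) tensor \<Rightarrow> 'c"
    and \<sigma> :: "'p \<Rightarrow> 'h \<Rightarrow> 'c"
  assumes component_module: "\<alpha> \<in> carrier G \<Longrightarrow> left_algebra_module K (H \<alpha>) (C \<alpha>) (\<omega> \<alpha>)"
    and sigma_linear: "\<alpha> \<in> carrier G \<Longrightarrow> linear_map K (H \<alpha>) (C \<alpha>) (\<sigma> \<alpha>)"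
    and sigma_surj: "\<alpha> \<in> carrier G \<Longrightarrow> \<sigma> \<alpha> ` carrier (H \<alpha>) = carrier (C \<alpha>)"
    and sigma_module_map: "\<lbrakk>\<alpha> \<in> carrier G; h \<in> carrier (H \<alpha>); x \<in> carrier (H \<alpha>)\<rbrakk> \<Longrightarrow>
      \<sigma> \<alpha> (h \<otimes>\<^bsub>H \<alpha>\<^esub> x) = \<omega> \<alpha> (pure_tensor K (H \<alpha>) (C \<alpha>) h (\<sigma> \<alpha> x))"
    and sigma_comult: "\<lbrakk>\<alpha> \<in> carrier G; \<beta> \<in> carrier G; x \<in> carrier (H (\<alpha> \<otimes> \<beta>))\<rbrakk> \<Longrightarrow>
      \<Delta>C \<alpha> \<beta> (\<sigma> (\<alpha> \<otimes> \<beta>) x) =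
      tensor_map K (H \<alpha>) (H \<beta>) (C \<alpha>) (C \<beta>) (\<sigma> \<alpha>) (\<sigma> \<beta>) (\<Delta>H \<alpha> \<beta> x)"
    and sigma_counit: "x \<in> carrier (H \<one>) \<Longrightarrow> \<epsilon>C (\<sigma> \<one> x) = \<epsilon>H x"

locale right_pi_comodule = pi_coalgebra K G C \<Delta> \<epsilon>
  for K :: "'k ring" and G :: "'p monoid" (structure)
    and C :: "'p \<Rightarrow> ('k, 'c) module"
    and \<Delta> :: "'p \<Rightarrow> 'p \<Rightarrow> 'c \<Rightarrow> ('k, 'c, 'c) tensor"
    and \<epsilon> :: "'c \<Rightarrow> 'k" +
  fixes M :: "'p \<Rightarrow> ('k, 'm) module"
    and \<theta> :: "'p \<Rightarrow> 'p \<Rightarrow> 'm \<Rightarrow> ('k, 'm, 'c) tensor"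
  assumes comodule_space: "\<alpha> \<in> carrier G \<Longrightarrow> vectorspace K (M \<alpha>)"
    and coaction_linear: "\<lbrakk>\<alpha> \<in> carrier G; \<beta> \<in> carrier G\<rbrakk> \<Longrightarrow>
      linear_map K (M (\<alpha> \<otimes> \<beta>)) (tensor_space K (M \<alpha>) (C \<beta>)) (\<theta> \<alpha> \<beta>)"
    and coaction_coassoc: "\<lbrakk>\<alpha> \<in> carrier G; \<beta> \<in> carrier G; \<gamma> \<in> carrier G;
        m \<in> carrier (M (\<alpha> \<otimes> \<beta> \<otimes> \<gamma>))\<rbrakk> \<Longrightarrow>
      tensor_assoc K (M \<alpha>) (C \<beta>) (C \<gamma>)
        (tensor_map K (M (\<alpha> \<otimes> \<beta>)) (C \<gamma>) (tensor_space K (M \<alpha>) (C \<beta>)) (C \<gamma>)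
          (\<theta> \<alpha> \<beta>) id (\<theta> (\<alpha> \<otimes> \<beta>) \<gamma> m)) =
      tensor_map K (M \<alpha>) (C (\<beta> \<otimes> \<gamma>)) (M \<alpha>) (tensor_space K (C \<beta>) (C \<gamma>))
          id (\<Delta> \<beta> \<gamma>) (\<theta> \<alpha> (\<beta> \<otimes> \<gamma>) m)"
    and coaction_counit: "\<lbrakk>\<alpha> \<in> carrier G; m \<in> carrier (M \<alpha>)\<rbrakk> \<Longrightarrow>
      tensor_map K (M \<alpha>) (C \<one>) (M \<alpha>) (ground_space K) id \<epsilon> (\<theta> \<alpha> \<one> m) =
      pure_tensor K (M \<alpha>) (ground_space K) m \<one>\<^bsub>K\<^esub>"

locale left_pi_comodule = pi_coalgebra K G C \<Delta> \<epsilon>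
  for K :: "'k ring" and G :: "'p monoid" (structure)
    and C :: "'p \<Rightarrow> ('k, 'c) module"
    and \<Delta> :: "'p \<Rightarrow> 'p \<Rightarrow> 'c \<Rightarrow> ('k, 'c, 'c) tensor"
    and \<epsilon> :: "'c \<Rightarrow> 'k" +
  fixes V :: "'p \<Rightarrow> ('k, 'v) module"
    and \<rho> :: "'p \<Rightarrow> 'p \<Rightarrow> 'v \<Rightarrow> ('k, 'c, 'v) tensor"
  assumes comodule_space: "\<alpha> \<in> carrier G \<Longrightarrow> vectorspace K (V \<alpha>)"
    and coaction_linear: "\<lbrakk>\<alpha> \<in> carrier G; \<beta> \<in> carrier G\<rbrakk> \<Longrightarrow>
      linear_map K (V (\<alpha> \<otimes> \<beta>)) (tensor_space K (C \<alpha>) (V \<beta>)) (\<rho> \<alpha> \<beta>)"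
    and coaction_coassoc: "\<lbrakk>\<alpha> \<in> carrier G; \<beta> \<in> carrier G; \<gamma> \<in> carrier G;
        v \<in> carrier (V (\<alpha> \<otimes> \<beta> \<otimes> \<gamma>))\<rbrakk> \<Longrightarrow>
      tensor_map K (C \<alpha>) (V (\<beta> \<otimes> \<gamma>)) (C \<alpha>) (tensor_space K (C \<beta>) (V \<gamma>))
          id (\<rho> \<beta> \<gamma>) (\<rho> \<alpha> (\<beta> \<otimes> \<gamma>) v) =
      tensor_assoc K (C \<alpha>) (C \<beta>) (V \<gamma>)
        (tensor_map K (C (\<alpha> \<otimes> \<beta>)) (V \<gamma>) (tensor_space K (C \<alpha>) (C \<beta>)) (V \<gamma>)
          (\<Delta> \<alpha> \<beta>) id (\<rho> (\<alpha> \<otimes> \<beta>) \<gamma> v))"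
    and coaction_counit: "\<lbrakk>\<alpha> \<in> carrier G; v \<in> carrier (V \<alpha>)\<rbrakk> \<Longrightarrow>
      tensor_map K (C \<one>) (V \<alpha>) (ground_space K) (V \<alpha>) \<epsilon> id (\<rho> \<one> \<alpha> v) =
      pure_tensor K (ground_space K) (V \<alpha>) \<one>\<^bsub>K\<^esub> v"

section \<open>The family \<open>W\<close> and its coaction\<close>

definition is_basis_family ::
  "'k ring \<Rightarrow> ('k, 'a) module \<Rightarrow> nat \<Rightarrow> (nat \<Rightarrow> 'a) \<Rightarrow> bool" where
  "is_basis_family K A n e \<longleftrightarrow> inj_on e {1..n} \<and> vectorspace.basis K A (e ` {1..n})"

definition is_dual_basis_family ::
  "'k ring \<Rightarrow> ('k, 'a) module \<Rightarrow> nat \<Rightarrow> (nat \<Rightarrow> 'a) \<Rightarrow> (nat \<Rightarrow> 'a \<Rightarrow> 'k) \<Rightarrow> bool" where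
  "is_dual_basis_family K A n e g \<longleftrightarrow>
     (\<forall>i\<in>{1..n}. linear_map K A (ground_space K) (g i)) \<and>
     (\<forall>i\<in>{1..n}. \<forall>j\<in>{1..n}. g i (e j) = (if i = j then \<one>\<^bsub>K\<^esub> else \<zero>\<^bsub>K\<^esub>))"

text \<open>Linear maps are represented by functions that are \<^const>\<open>undefined\<close> outside \<open>carrier A\<close>,
  so that equality in \<open>hom_space\<close> is equality on \<open>carrier A\<close>.\<close>

definition hom_space ::
  "'k ring \<Rightarrow> ('k, 'a) module \<Rightarrow> ('k, 'b) module \<Rightarrow> ('k, 'a \<Rightarrow> 'b) module" where
  "hom_space K A B = \<lparr>carrier = module_hom K A B \<inter> extensional (carrier A),
     mult = undefined, one = undefined,
     zero = (\<lambda>x\<in>carrier A. \<zero>\<^bsub>B\<^esub>),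
     add = (\<lambda>f g. \<lambda>x\<in>carrier A. f x \<oplus>\<^bsub>B\<^esub> g x),
     smult = (\<lambda>k f. \<lambda>x\<in>carrier A. k \<odot>\<^bsub>B\<^esub> f x)\<rparr>"

definition left_translation ::
  "'k ring \<Rightarrow> 'p monoid \<Rightarrow> ('p \<Rightarrow> ('k, 'h) module) \<Rightarrow>
   ('p \<Rightarrow> 'p \<Rightarrow> 'h \<Rightarrow> ('k, 'h, 'h) tensor) \<Rightarrow>
   ('p \<Rightarrow> ('k, 'c) module) \<Rightarrow> ('p \<Rightarrow> 'h \<Rightarrow> 'c) \<Rightarrow> 'p \<Rightarrow> 'h \<Rightarrow> ('k, 'c, 'h) tensor" where
  "left_translation K G H \<Delta>H C \<sigma> \<alpha> x =
     tensor_map K (H \<one>\<^bsub>G\<^esub>) (H \<alpha>) (C \<one>\<^bsub>G\<^esub>) (H \<alpha>) (\<sigma> \<one>\<^bsub>G\<^esub>) id (\<Delta>H \<one>\<^bsub>G\<^esub> \<alpha> x)"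

definition W_space ::
  "'k ring \<Rightarrow> 'p monoid \<Rightarrow> ('p \<Rightarrow> ('k, 'h) module) \<Rightarrow>
   ('p \<Rightarrow> 'p \<Rightarrow> 'h \<Rightarrow> ('k, 'h, 'h) tensor) \<Rightarrow>
   ('p \<Rightarrow> ('k, 'c) module) \<Rightarrow> ('p \<Rightarrow> 'h \<Rightarrow> 'c) \<Rightarrow>
   ('p \<Rightarrow> ('k, 'v) module) \<Rightarrow> ('p \<Rightarrow> 'p \<Rightarrow> 'v \<Rightarrow> ('k, 'c, 'v) tensor) \<Rightarrow>
   'p \<Rightarrow> ('k, 'v \<Rightarrow> 'h) module" where
  "W_space K G H \<Delta>H C \<sigma> V \<rho> \<alpha> =
    (hom_space K (V \<one>\<^bsub>G\<^esub>) (H \<alpha>))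
      \<lparr>carrier := {F \<in> carrier (hom_space K (V \<one>\<^bsub>G\<^esub>) (H \<alpha>)). \<forall>v\<in>carrier (V \<one>\<^bsub>G\<^esub>).
          left_translation K G H \<Delta>H C \<sigma> \<alpha> (F v) =
          tensor_map K (C \<one>\<^bsub>G\<^esub>) (V \<one>\<^bsub>G\<^esub>) (C \<one>\<^bsub>G\<^esub>) (H \<alpha>) id F (\<rho> \<one>\<^bsub>G\<^esub> \<one>\<^bsub>G\<^esub> v)}\<rparr>"

text \<open>The map \<open>\<sim>(I\<^sub>\<alpha> \<otimes> \<phi>) \<Delta>\<^sub>\<alpha>\<^sub>,\<^sub>\<beta> F : V\<^sub>1 \<rightarrow> H\<^sub>\<alpha>\<close> for a functional \<open>\<phi>\<close> on \<open>H\<^sub>\<beta>\<close>.\<close>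

definition W_contract ::
  "'k ring \<Rightarrow> 'p monoid \<Rightarrow> ('p \<Rightarrow> ('k, 'h) module) \<Rightarrow>
   ('p \<Rightarrow> 'p \<Rightarrow> 'h \<Rightarrow> ('k, 'h, 'h) tensor) \<Rightarrow> ('p \<Rightarrow> ('k, 'v) module) \<Rightarrow>
   'p \<Rightarrow> 'p \<Rightarrow> ('h \<Rightarrow> 'k) \<Rightarrow> ('v \<Rightarrow> 'h) \<Rightarrow> 'v \<Rightarrow> 'h" where
  "W_contract K G H \<Delta>H V \<alpha> \<beta> \<phi> F = (\<lambda>v\<in>carrier (V \<one>\<^bsub>G\<^esub>).
     tensor_runit K (H \<alpha>)
       (tensor_map K (H \<alpha>) (H \<beta>) (H \<alpha>) (ground_space K) id \<phi> (\<Delta>H \<alpha> \<beta> (F v))))"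

definition W_coaction ::
  "'k ring \<Rightarrow> 'p monoid \<Rightarrow> ('p \<Rightarrow> ('k, 'h) module) \<Rightarrow>
   ('p \<Rightarrow> 'p \<Rightarrow> 'h \<Rightarrow> ('k, 'h, 'h) tensor) \<Rightarrow>
   ('p \<Rightarrow> ('k, 'c) module) \<Rightarrow> ('p \<Rightarrow> 'h \<Rightarrow> 'c) \<Rightarrow>
   ('p \<Rightarrow> ('k, 'v) module) \<Rightarrow> ('p \<Rightarrow> 'p \<Rightarrow> 'v \<Rightarrow> ('k, 'c, 'v) tensor) \<Rightarrow>
   ('p \<Rightarrow> nat) \<Rightarrow> ('p \<Rightarrow> nat \<Rightarrow> 'h) \<Rightarrow> ('p \<Rightarrow> nat \<Rightarrow> 'h \<Rightarrow> 'k) \<Rightarrow>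
   'p \<Rightarrow> 'p \<Rightarrow> ('v \<Rightarrow> 'h) \<Rightarrow> ('k, 'v \<Rightarrow> 'h, 'h) tensor" where
  "W_coaction K G H \<Delta>H C \<sigma> V \<rho> n e g \<alpha> \<beta> F =
    (let W = W_space K G H \<Delta>H C \<sigma> V \<rho> in
      \<Oplus>\<^bsub>tensor_space K (W \<alpha>) (H \<beta>)\<^esub>i\<in>{1..n \<beta>}.
        pure_tensor K (W \<alpha>) (H \<beta>) (W_contract K G H \<Delta>H V \<alpha> \<beta> (g \<beta> i) F) (e \<beta> i))"

end

theory Submission
  imports Defs
begin

text \<open>
  For \<open>v \<in> V\<^sub>1\<close> let \<open>ev\<^sub>v : W\<^sub>\<alpha> \<rightarrow> H\<^sub>\<alpha>\<close> be evaluation at \<open>v\<close>. If \<open>D\<close> is finite dimensional, the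
  maps \<open>ev\<^sub>v \<otimes> id : W\<^sub>\<alpha> \<otimes> D \<rightarrow> H\<^sub>\<alpha> \<otimes> D\<close> are jointly injective, and
  \<open>(ev\<^sub>v \<otimes> id) (\<Omega>\<^sub>\<alpha>\<^sub>,\<^sub>\<beta> F) = \<Delta>\<^sub>\<alpha>\<^sub>,\<^sub>\<beta> (F v)\<close> by expanding in the basis of \<open>H\<^sub>\<beta>\<close>. Hence linearity,
  coassociativity and counitality of \<open>\<Omega>\<close> reduce, by naturality, to those of \<open>\<Delta>\<close>, with
  \<open>D = H\<^sub>\<beta>\<close>, \<open>H\<^sub>\<beta> \<otimes> H\<^sub>\<gamma>\<close> and \<open>K\<close> respectively.

  The values of \<open>\<Omega>\<close> lie in \<open>W\<^sub>\<alpha> \<otimes> H\<^sub>\<beta>\<close> because \<open>\<kappa> = (id \<otimes> \<chi>) \<Delta>\<^sub>\<alpha>\<^sub>,\<^sub>\<beta> : H\<^sub>\<alpha>\<^sub>\<beta> \<rightarrow> H\<^sub>\<alpha>\<close> satisfies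
  \<open>L\<^sub>1\<^sub>,\<^sub>\<alpha> \<kappa> = (id \<otimes> \<kappa>) L\<^sub>1\<^sub>,\<^sub>\<alpha>\<^sub>\<beta>\<close> for every functional \<open>\<chi>\<close>, again by coassociativity of \<open>\<Delta>\<close>.
\<close>

section \<open>Linear maps, free spaces and quotients\<close>

lemma module_homI:
  assumes "\<And>x. x \<in> carrier M \<Longrightarrow> f x \<in> carrier N"
    and "\<And>x y. \<lbrakk>x \<in> carrier M; y \<in> carrier M\<rbrakk> \<Longrightarrow> f (x \<oplus>\<^bsub>M\<^esub> y) = f x \<oplus>\<^bsub>N\<^esub> f y"
    and "\<And>r x. \<lbrakk>r \<in> carrier R; x \<in> carrier M\<rbrakk> \<Longrightarrow> f (r \<odot>\<^bsub>M\<^esub> x) = r \<odot>\<^bsub>N\<^esub> f x"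
  shows "f \<in> module_hom R M N"
  using assms by (auto simp: module_hom_def)

lemma module_hom_mem: "\<lbrakk>f \<in> module_hom R M N; x \<in> carrier M\<rbrakk> \<Longrightarrow> f x \<in> carrier N"
  by (auto simp: module_hom_def)

text \<open>Membership tests values on \<open>carrier M\<close> alone. The module structure of
  \<open>M\<close> keeps sums and scalar multiples in that carrier, where the two functions
  agree.\<close>

lemma module_hom_cong:
  assumes "\<And>x. x \<in> carrier M \<Longrightarrow> f x = g x" "module R M"
  shows "f \<in> module_hom R M N \<longleftrightarrow> g \<in> module_hom R M N"
proof -
  interpret module R M by fact
  show ?thesis using assms(1) by (simp add: module_hom_def Pi_iff)
qed

lemma module_hom_id: "id \<in> module_hom R M M"
  by (simp add: module_hom_def)

lemma module_hom_comp:
  "\<lbrakk>g \<in> module_hom R N P; f \<in> module_hom R M N\<rbrakk> \<Longrightarrow> g \<circ> f \<in> module_hom R M P"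
  by (auto simp: module_hom_def Pi_iff)

lemma module_hom_zero:
  assumes "module R M" "module R N" "f \<in> module_hom R M N"
  shows "f \<zero>\<^bsub>M\<^esub> = \<zero>\<^bsub>N\<^esub>"
proof -
  interpret mod_hom R M N f
    using assms by (simp add: mod_hom_def mod_hom_axioms_def)
  show ?thesis by simp
qed

lemma module_hom_finsum:
  assumes "module R M" "module R N" "f \<in> module_hom R M N" "h \<in> I \<rightarrow> carrier M"
  shows "f (\<Oplus>\<^bsub>M\<^esub>i\<in>I. h i) = (\<Oplus>\<^bsub>N\<^esub>i\<in>I. f (h i))"
proof -
  interpret M: module R M by fact
  interpret N: module R N by fact
  show ?thesis using assms(4)
  \<comment> \<open>Over an infinite index set both sums are zero by the convention of
    \<open>finsum\<close>, so that case asks just that zero goes to zero.\<close>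
  proof (induction I rule: infinite_finite_induct)
    case (insert i I)
    then show ?case
      using module_hom_mem[OF assms(3)] module_hom_add[OF assms(3)] by (simp add: Pi_iff)
  qed (use module_hom_zero[OF assms(1-3)] in simp_all)
qed

text \<open>Passes from the locale of linear maps to the plain set \<open>module_hom\<close>, in
  which almost the whole development computes.\<close>

lemma linear_map_iff:
  "linear_map K V W T \<longleftrightarrow> vectorspace K V \<and> vectorspace K W \<and> T \<in> module_hom K V W"
  by (auto simp: linear_map_def mod_hom_def mod_hom_axioms_def vectorspace_def)

section \<open>Free spaces and linear extension\<close>

definition free_lift :: "'k ring \<Rightarrow> 'x set \<Rightarrow> ('k, 'd) module \<Rightarrow> ('x \<Rightarrow> 'd) \<Rightarrow> ('x \<Rightarrow> 'k) \<Rightarrow> 'd" where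
  "free_lift K X D \<psi> f = (\<Oplus>\<^bsub>D\<^esub>x\<in>{x \<in> X. f x \<noteq> \<zero>\<^bsub>K\<^esub>}. f x \<odot>\<^bsub>D\<^esub> \<psi> x)"

context
  fixes R :: "'k ring" (structure)
  assumes cring: "cring R"
begin

interpretation cring R by (rule cring)

lemma carrier_free_space:
  "carrier (free_space R X) = {f \<in> X \<rightarrow>\<^sub>E carrier R. finite {x \<in> X. f x \<noteq> \<zero>}}"
  by (simp add: free_space_def)

lemma free_space_ops [simp]:
  "\<zero>\<^bsub>free_space R X\<^esub> = (\<lambda>x\<in>X. \<zero>)"
  "f \<oplus>\<^bsub>free_space R X\<^esub> g = (\<lambda>x\<in>X. f x \<oplus> g x)"
  "k \<odot>\<^bsub>free_space R X\<^esub> f = (\<lambda>x\<in>X. k \<otimes> f x)"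
  by (simp_all add: free_space_def func_space_def)

lemma free_space_module: "module R (free_space R X)"
proof -
  interpret F: module R "func_space X" by (rule func_space_is_module)
  \<comment> \<open>The finitely supported functions sit inside the space of all functions on
    \<open>X\<close>: a sum is supported in the union of the two supports, a scalar multiple in the
    old support.\<close>
  have "submodule R {f \<in> X \<rightarrow>\<^sub>E carrier R. finite {x \<in> X. f x \<noteq> \<zero>}} (func_space X)"
  proof (unfold_locales, goal_cases)
    case (2 f g)
    have "{x \<in> X. (f \<oplus>\<^bsub>func_space X\<^esub> g) x \<noteq> \<zero>} \<subseteq> {x \<in> X. f x \<noteq> \<zero>} \<union> {x \<in> X. g x \<noteq> \<zero>}"
      using 2 by (auto simp: func_space_def)
    then have "finite {x \<in> X. (f \<oplus>\<^bsub>func_space X\<^esub> g) x \<noteq> \<zero>}"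
      using 2 by (auto intro: finite_subset)
    then show ?case
      using 2 by (auto simp: func_space_def PiE_mem2)
  next
    case (4 c f)
    have "{x \<in> X. (c \<odot>\<^bsub>func_space X\<^esub> f) x \<noteq> \<zero>} \<subseteq> {x \<in> X. f x \<noteq> \<zero>}"
      using 4 by (auto simp: func_space_def)
    then have "finite {x \<in> X. (c \<odot>\<^bsub>func_space X\<^esub> f) x \<noteq> \<zero>}"
      using 4 by (auto intro: finite_subset)
    then show ?case
      using 4 by (auto simp: func_space_def PiE_mem2)
  qed (auto simp: func_space_def cong: conj_cong)
  then show ?thesis
    unfolding free_space_def by (rule F.submodule_is_module)
qed

lemma free_gen_closed: "x \<in> X \<Longrightarrow> free_gen R X x \<in> carrier (free_space R X)"
  by (auto simp: carrier_free_space free_gen_def intro: finite_subset[of _ "{x}"])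

text \<open>Induction on the support: one point is split off as a multiple of its generator, and
  what remains has one support point fewer.\<close>

lemma free_space_induct [consumes 1, case_names zero gen]:
  assumes "f \<in> carrier (free_space R X)"
    and zero: "P \<zero>\<^bsub>free_space R X\<^esub>"
    and gen: "\<And>k x g. \<lbrakk>k \<in> carrier R; x \<in> X; g \<in> carrier (free_space R X); P g\<rbrakk> \<Longrightarrow>
      P (k \<odot>\<^bsub>free_space R X\<^esub> free_gen R X x \<oplus>\<^bsub>free_space R X\<^esub> g)"
  shows "P f"
proof -
  have "P f" if "finite S" "f \<in> carrier (free_space R X)" "{x \<in> X. f x \<noteq> \<zero>} = S" for S f
    using that
  proof (induction S arbitrary: f)
    case empty
    then have "f = (\<lambda>x\<in>X. \<zero>)"
      by (auto simp: carrier_free_space PiE_def extensional_def)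
    then show ?case using zero by (simp only: free_space_ops)
  next
    case (insert x S)
    \<comment> \<open>The function with its value at \<open>x\<close> erased; the restriction to
      \<open>X\<close> keeps it extensional, as the carrier demands.\<close>
    let ?g = "\<lambda>y\<in>X. if y = x then \<zero> else f y"
    have x: "x \<in> X" using insert.prems by auto
    have supp: "{y \<in> X. ?g y \<noteq> \<zero>} = S"
      using insert by auto
    have g: "?g \<in> carrier (free_space R X)"
      unfolding carrier_free_space mem_Collect_eq supp
      using insert.prems insert.hyps by (auto simp: carrier_free_space)
    have "f y = (f x \<odot>\<^bsub>free_space R X\<^esub> free_gen R X x \<oplus>\<^bsub>free_space R X\<^esub> ?g) y" for y
      using insert.prems x by (auto simp: carrier_free_space free_gen_def PiE_def extensional_def Pi_iff)
    then have "f = f x \<odot>\<^bsub>free_space R X\<^esub> free_gen R X x \<oplus>\<^bsub>free_space R X\<^esub> ?g" ..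
    moreover have "f x \<in> carrier R" using insert.prems x by (auto simp: carrier_free_space)
    ultimately show ?case
      using gen[OF _ x g] insert.IH[OF g supp] by metis
  qed
  then show ?thesis using assms(1) by (auto simp: carrier_free_space)
qed

text \<open>The range of summation depends on \<open>f\<close>, which blocks comparing the sums of
  different functions. Terms outside the support vanish, so any finite subset of \<open>X\<close>
  containing it may be summed over instead.\<close>

lemma free_lift_superset:
  assumes "module R D" "\<psi> \<in> X \<rightarrow> carrier D" "f \<in> X \<rightarrow> carrier R"
    and "finite S" "S \<subseteq> X" "{x \<in> X. f x \<noteq> \<zero>} \<subseteq> S"
  shows "free_lift R X D \<psi> f = (\<Oplus>\<^bsub>D\<^esub>x\<in>S. f x \<odot>\<^bsub>D\<^esub> \<psi> x)"
proof -
  interpret D: module R D by fact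
  have "f x \<odot>\<^bsub>D\<^esub> \<psi> x = \<zero>\<^bsub>D\<^esub>" if "x \<in> S - {x \<in> X. f x \<noteq> \<zero>}" for x
    using that assms by (auto simp: Pi_iff subset_iff)
  then show ?thesis
    unfolding free_lift_def
    using assms by (intro D.add.finprod_mono_neutral_cong_left) (auto simp: Pi_iff)
qed

lemma free_lift_hom:
  assumes "module R D" "\<psi> \<in> X \<rightarrow> carrier D"
  shows "free_lift R X D \<psi> \<in> module_hom R (free_space R X) D"
proof -
  interpret D: module R D by fact
  interpret F: module R "free_space R X" by (rule free_space_module)
  note lift = free_lift_superset[OF assms]
  show ?thesis
  proof (rule module_homI)
    fix f assume f: "f \<in> carrier (free_space R X)"
    then show "free_lift R X D \<psi> f \<in> carrier D"
      using assms(2) unfolding free_lift_def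
      by (intro D.finsum_closed) (auto simp: carrier_free_space Pi_iff)
    fix g assume g: "g \<in> carrier (free_space R X)"
    \<comment> \<open>Cancellation can make the support of the sum smaller than this union, so all
      three sums are taken over the union.\<close>
    let ?S = "{x \<in> X. f x \<noteq> \<zero>} \<union> {x \<in> X. g x \<noteq> \<zero>}"
    have cf: "\<And>x. x \<in> X \<Longrightarrow> f x \<in> carrier R" "\<And>x. x \<in> X \<Longrightarrow> g x \<in> carrier R"
      using f g by (auto simp: carrier_free_space)
    have S: "finite ?S" "?S \<subseteq> X"
      using f g by (auto simp: carrier_free_space)
    have "free_lift R X D \<psi> (f \<oplus>\<^bsub>free_space R X\<^esub> g) =
      (\<Oplus>\<^bsub>D\<^esub>x\<in>?S. (f \<oplus>\<^bsub>free_space R X\<^esub> g) x \<odot>\<^bsub>D\<^esub> \<psi> x)"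
      using cf S by (intro lift) auto
    also have "\<dots> = (\<Oplus>\<^bsub>D\<^esub>x\<in>?S. f x \<odot>\<^bsub>D\<^esub> \<psi> x \<oplus>\<^bsub>D\<^esub> g x \<odot>\<^bsub>D\<^esub> \<psi> x)"
      using cf S assms(2) by (intro D.finsum_cong') (auto simp: D.smult_l_distr Pi_iff)
    also have "\<dots> = (\<Oplus>\<^bsub>D\<^esub>x\<in>?S. f x \<odot>\<^bsub>D\<^esub> \<psi> x) \<oplus>\<^bsub>D\<^esub> (\<Oplus>\<^bsub>D\<^esub>x\<in>?S. g x \<odot>\<^bsub>D\<^esub> \<psi> x)"
      using cf S assms(2) by (intro D.finsum_addf) (auto simp: Pi_iff)
    also have "(\<Oplus>\<^bsub>D\<^esub>x\<in>?S. f x \<odot>\<^bsub>D\<^esub> \<psi> x) = free_lift R X D \<psi> f"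
      using cf S by (intro lift[symmetric]) auto
    also have "(\<Oplus>\<^bsub>D\<^esub>x\<in>?S. g x \<odot>\<^bsub>D\<^esub> \<psi> x) = free_lift R X D \<psi> g"
      using cf S by (intro lift[symmetric]) auto
    finally show "free_lift R X D \<psi> (f \<oplus>\<^bsub>free_space R X\<^esub> g) =
      free_lift R X D \<psi> f \<oplus>\<^bsub>D\<^esub> free_lift R X D \<psi> g" .
  next
    fix k f assume k: "k \<in> carrier R" and f: "f \<in> carrier (free_space R X)"
    let ?S = "{x \<in> X. f x \<noteq> \<zero>}"
    have cf: "\<And>x. x \<in> X \<Longrightarrow> f x \<in> carrier R" and S: "finite ?S" "?S \<subseteq> X"
      using f by (auto simp: carrier_free_space)
    have "free_lift R X D \<psi> (k \<odot>\<^bsub>free_space R X\<^esub> f) =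
      (\<Oplus>\<^bsub>D\<^esub>x\<in>?S. (k \<odot>\<^bsub>free_space R X\<^esub> f) x \<odot>\<^bsub>D\<^esub> \<psi> x)"
      using cf S k by (intro lift) auto
    also have "\<dots> = (\<Oplus>\<^bsub>D\<^esub>x\<in>?S. k \<odot>\<^bsub>D\<^esub> (f x \<odot>\<^bsub>D\<^esub> \<psi> x))"
      using cf S k assms(2) by (intro D.finsum_cong') (auto simp: D.smult_assoc1 Pi_iff)
    also have "\<dots> = k \<odot>\<^bsub>D\<^esub> free_lift R X D \<psi> f"
      using cf S k assms(2) unfolding free_lift_def
      by (intro D.finsum_smult[symmetric]) (auto simp: Pi_iff)
    finally show "free_lift R X D \<psi> (k \<odot>\<^bsub>free_space R X\<^esub> f) = k \<odot>\<^bsub>D\<^esub> free_lift R X D \<psi> f" .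
  qed
qed

lemma free_lift_gen:
  assumes "module R D" "\<psi> \<in> X \<rightarrow> carrier D" "x \<in> X"
  shows "free_lift R X D \<psi> (free_gen R X x) = \<psi> x"
proof -
  interpret D: module R D by fact
  have "free_lift R X D \<psi> (free_gen R X x) = (\<Oplus>\<^bsub>D\<^esub>y\<in>{x}. free_gen R X x y \<odot>\<^bsub>D\<^esub> \<psi> y)"
    using assms by (intro free_lift_superset) (auto simp: free_gen_def)
  also have "\<dots> = \<psi> x"
    using assms by (simp add: free_gen_def Pi_iff)
  finally show ?thesis .
qed

end

section \<open>Quotients by submodules\<close>

definition quotient_space :: "('a, 'b) module \<Rightarrow> 'b set \<Rightarrow> ('a, 'b set) module" where
  "quotient_space M N = \<lparr>carrier = a_rcosets\<^bsub>M\<^esub> N, mult = undefined, one = undefined, zero = N,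
     add = set_add M, smult = (\<lambda>k X. \<Union>x\<in>X. N +>\<^bsub>M\<^esub> (k \<odot>\<^bsub>M\<^esub> x))\<rparr>"

context
  fixes R :: "'a ring" and M :: "('a, 'b) module" and N
  assumes sub: "submodule R N M"
begin

interpretation sub: submodule R N M by (rule sub)
interpretation M: module R M by (rule sub.module)

lemma submodule_abelian_subgroup: "abelian_subgroup N M"
proof (rule abelian_subgroupI3)
  \<comment> \<open>Closure under negation comes from multiplying by minus one.\<close>
  have "\<ominus>\<^bsub>M\<^esub> x \<in> N" if "x \<in> N" for x
    using that sub.subset sub.smult_closed[of "\<ominus>\<^bsub>R\<^esub> \<one>\<^bsub>R\<^esub>" x] M.smult_l_minus[of "\<one>\<^bsub>R\<^esub>" x]
    by (simp add: subset_iff)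
  then show "additive_subgroup N M"
    using sub.subset sub.zero_closed
    by (intro additive_subgroupI M.add.subgroupI) blast+
qed (rule M.abelian_group_axioms)

interpretation A: abelian_subgroup N M by (rule submodule_abelian_subgroup)

lemma carrier_quotient_space:
  "X \<in> carrier (quotient_space M N) \<longleftrightarrow> (\<exists>x\<in>carrier M. X = N +>\<^bsub>M\<^esub> x)"
  by (auto simp: quotient_space_def A_RCOSETS_def')

lemma quotient_space_zero: "\<zero>\<^bsub>quotient_space M N\<^esub> = N +>\<^bsub>M\<^esub> \<zero>\<^bsub>M\<^esub>"
  using sub.subset by (simp add: quotient_space_def)

lemma quotient_space_add:
  "\<lbrakk>x \<in> carrier M; y \<in> carrier M\<rbrakk> \<Longrightarrow>
    (N +>\<^bsub>M\<^esub> x) \<oplus>\<^bsub>quotient_space M N\<^esub> (N +>\<^bsub>M\<^esub> y) = N +>\<^bsub>M\<^esub> (x \<oplus>\<^bsub>M\<^esub> y)"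
  by (simp add: quotient_space_def A.a_rcos_sum)

lemma coset_eqI:
  assumes "x \<in> carrier M" "y \<in> carrier M" "x \<ominus>\<^bsub>M\<^esub> y \<in> N"
  shows "N +>\<^bsub>M\<^esub> x = N +>\<^bsub>M\<^esub> y"
  using assms A.a_rcos_module_rev[of y x] A.a_repr_independence'[of x y]
  by (simp add: a_minus_def)

text \<open>The union defining the scalar multiple runs over all representatives. Two of them differ
  by an element of \<open>N\<close>, and so do their multiples; hence the union is that of a
  constant nonempty family.\<close>

lemma quotient_space_smult:
  assumes "k \<in> carrier R" "x \<in> carrier M"
  shows "k \<odot>\<^bsub>quotient_space M N\<^esub> (N +>\<^bsub>M\<^esub> x) = N +>\<^bsub>M\<^esub> (k \<odot>\<^bsub>M\<^esub> x)"
proof -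
  have "N +>\<^bsub>M\<^esub> (k \<odot>\<^bsub>M\<^esub> y) = N +>\<^bsub>M\<^esub> (k \<odot>\<^bsub>M\<^esub> x)" if "y \<in> N +>\<^bsub>M\<^esub> x" for y
  proof (rule coset_eqI)
    have y: "y \<in> carrier M" using that assms A.a_elemrcos_carrier by blast
    show "k \<odot>\<^bsub>M\<^esub> y \<in> carrier M" "k \<odot>\<^bsub>M\<^esub> x \<in> carrier M" using y assms by auto
    have "k \<odot>\<^bsub>M\<^esub> y \<ominus>\<^bsub>M\<^esub> k \<odot>\<^bsub>M\<^esub> x = k \<odot>\<^bsub>M\<^esub> (y \<ominus>\<^bsub>M\<^esub> x)"
      using y assms by (simp add: a_minus_def M.smult_r_distr M.smult_r_minus)
    moreover have "y \<ominus>\<^bsub>M\<^esub> x \<in> N"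
      using A.a_rcos_module_imp[OF assms(2) that] by (simp add: a_minus_def)
    ultimately show "k \<odot>\<^bsub>M\<^esub> y \<ominus>\<^bsub>M\<^esub> k \<odot>\<^bsub>M\<^esub> x \<in> N" using assms by simp
  qed
  moreover have "x \<in> N +>\<^bsub>M\<^esub> x" using assms A.a_rcos_self by blast
  ultimately show ?thesis
    unfolding quotient_space_def module.simps by (intro UN_constant_eq ballI)
qed

text \<open>The laws are inherited from \<open>M\<close> through representatives. Existence of
  additive inverses is shown first, with the coset of the negative as witness.\<close>

lemma quotient_space_module: "module R (quotient_space M N)"
proof -
  note [simp] = quotient_space_zero quotient_space_add quotient_space_smult
  have ex: "\<exists>w\<in>carrier (quotient_space M N).
      v \<oplus>\<^bsub>quotient_space M N\<^esub> w = \<zero>\<^bsub>quotient_space M N\<^esub>"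
    if "v \<in> carrier (quotient_space M N)" for v
  proof -
    obtain x where x: "x \<in> carrier M" "v = N +>\<^bsub>M\<^esub> x"
      using \<open>v \<in> _\<close> by (auto simp: carrier_quotient_space)
    then have "v \<oplus>\<^bsub>quotient_space M N\<^esub> (N +>\<^bsub>M\<^esub> \<ominus>\<^bsub>M\<^esub> x) = \<zero>\<^bsub>quotient_space M N\<^esub>"
      by (simp add: M.r_neg)
    then show ?thesis using x(1)
      by (intro bexI[of _ "N +>\<^bsub>M\<^esub> \<ominus>\<^bsub>M\<^esub> x"]) (auto simp: carrier_quotient_space)
  qed
  have "N +>\<^bsub>M\<^esub> x \<in> carrier (quotient_space M N)" if "x \<in> carrier M" for x
    using that by (auto simp: carrier_quotient_space)
  note [simp] = this
  show ?thesis
    by (rule module_criteria[OF M.R.cring_axioms])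
      (use ex in \<open>auto simp: carrier_quotient_space M.a_ac M.smult_assoc1 M.smult_l_distr M.smult_r_distr\<close>)
qed

lemma quotient_map_hom: "(\<lambda>x. N +>\<^bsub>M\<^esub> x) \<in> module_hom R M (quotient_space M N)"
  by (rule module_homI)
    (auto simp: carrier_quotient_space quotient_space_add quotient_space_smult)

text \<open>Elements of the coset differ from \<open>x\<close> by elements of \<open>N\<close>,
  which \<open>h\<close> kills. The singleton form is what \<open>the_elem\<close> in
  \<open>tensor_lift\<close> consumes.\<close>

lemma module_hom_image_coset:
  assumes "module R D" "h \<in> module_hom R M D" "\<And>y. y \<in> N \<Longrightarrow> h y = \<zero>\<^bsub>D\<^esub>" "x \<in> carrier M"
  shows "h ` (N +>\<^bsub>M\<^esub> x) = {h x}"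
proof -
  interpret D: module R D by fact
  have "h (y \<oplus>\<^bsub>M\<^esub> x) = h x" if "y \<in> N" for y
    using that assms module_hom_add[OF assms(2), of y x] sub.subset module_hom_mem[OF assms(2)]
    by auto
  moreover have "N +>\<^bsub>M\<^esub> x = (\<lambda>y. y \<oplus>\<^bsub>M\<^esub> x) ` N"
    by (auto simp: a_r_coset_def')
  ultimately have "h ` (N +>\<^bsub>M\<^esub> x) = (\<lambda>_. h x) ` N"
    by (simp add: image_image cong: image_cong_simp)
  also have "\<dots> = {h x}" using sub.zero_closed by (rule image_constant)
  finally show ?thesis .
qed

end

section \<open>The universal property of the tensor product\<close>

definition bilinear_map ::
  "'k ring \<Rightarrow> ('k, 'a) module \<Rightarrow> ('k, 'b) module \<Rightarrow> ('k, 'c) module \<Rightarrow> ('a \<Rightarrow> 'b \<Rightarrow> 'c) \<Rightarrow> bool" where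
  "bilinear_map K A B D \<phi> \<longleftrightarrow>
     (\<forall>a\<in>carrier A. \<phi> a \<in> module_hom K B D) \<and>
     (\<forall>b\<in>carrier B. (\<lambda>a. \<phi> a b) \<in> module_hom K A D)"

lemma bilinear_mapI:
  assumes "\<And>a. a \<in> carrier A \<Longrightarrow> \<phi> a \<in> module_hom K B D"
    and "\<And>b. b \<in> carrier B \<Longrightarrow> (\<lambda>a. \<phi> a b) \<in> module_hom K A D"
  shows "bilinear_map K A B D \<phi>"
  using assms by (simp add: bilinear_map_def)

lemma bilinear_mapD:
  assumes "bilinear_map K A B D \<phi>"
  shows "\<lbrakk>a \<in> carrier A; b \<in> carrier B\<rbrakk> \<Longrightarrow> \<phi> a b \<in> carrier D"
    and "\<lbrakk>a \<in> carrier A; a' \<in> carrier A; b \<in> carrier B\<rbrakk> \<Longrightarrow>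
      \<phi> (a \<oplus>\<^bsub>A\<^esub> a') b = \<phi> a b \<oplus>\<^bsub>D\<^esub> \<phi> a' b"
    and "\<lbrakk>a \<in> carrier A; b \<in> carrier B; b' \<in> carrier B\<rbrakk> \<Longrightarrow>
      \<phi> a (b \<oplus>\<^bsub>B\<^esub> b') = \<phi> a b \<oplus>\<^bsub>D\<^esub> \<phi> a b'"
    and "\<lbrakk>k \<in> carrier K; a \<in> carrier A; b \<in> carrier B\<rbrakk> \<Longrightarrow> \<phi> (k \<odot>\<^bsub>A\<^esub> a) b = k \<odot>\<^bsub>D\<^esub> \<phi> a b"
    and "\<lbrakk>k \<in> carrier K; a \<in> carrier A; b \<in> carrier B\<rbrakk> \<Longrightarrow> \<phi> a (k \<odot>\<^bsub>B\<^esub> b) = k \<odot>\<^bsub>D\<^esub> \<phi> a b"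
proof -
  have l: "\<phi> a \<in> module_hom K B D" if "a \<in> carrier A" for a
    using assms that by (simp add: bilinear_map_def)
  have r: "(\<lambda>a. \<phi> a b) \<in> module_hom K A D" if "b \<in> carrier B" for b
    using assms that by (simp add: bilinear_map_def)
  show "\<lbrakk>a \<in> carrier A; b \<in> carrier B\<rbrakk> \<Longrightarrow> \<phi> a b \<in> carrier D"
    by (rule module_hom_mem[OF l])
  show "\<lbrakk>a \<in> carrier A; b \<in> carrier B; b' \<in> carrier B\<rbrakk> \<Longrightarrow>
      \<phi> a (b \<oplus>\<^bsub>B\<^esub> b') = \<phi> a b \<oplus>\<^bsub>D\<^esub> \<phi> a b'"
    by (rule module_hom_add[OF l])
  show "\<lbrakk>k \<in> carrier K; a \<in> carrier A; b \<in> carrier B\<rbrakk> \<Longrightarrow> \<phi> a (k \<odot>\<^bsub>B\<^esub> b) = k \<odot>\<^bsub>D\<^esub> \<phi> a b"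
    by (rule module_hom_smult[OF l])
  show "\<lbrakk>a \<in> carrier A; a' \<in> carrier A; b \<in> carrier B\<rbrakk> \<Longrightarrow>
      \<phi> (a \<oplus>\<^bsub>A\<^esub> a') b = \<phi> a b \<oplus>\<^bsub>D\<^esub> \<phi> a' b"
    by (rule module_hom_add[OF r])
  show "\<lbrakk>k \<in> carrier K; a \<in> carrier A; b \<in> carrier B\<rbrakk> \<Longrightarrow> \<phi> (k \<odot>\<^bsub>A\<^esub> a) b = k \<odot>\<^bsub>D\<^esub> \<phi> a b"
    by (rule module_hom_smult[OF r])
qed

lemma tensor_space_quotient:
  "tensor_space K A B =
     quotient_space (free_space K (carrier A \<times> carrier B)) (tensor_null K A B)"
  by (simp add: tensor_space_def quotient_space_def Let_def)

context
  fixes K :: "'k ring" and A :: "('k, 'a) module" and B :: "('k, 'b) module"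
  assumes A: "module K A" and B: "module K B"
begin

interpretation A: module K A by (rule A)
interpretation B: module K B by (rule B)

private abbreviation (input) "X \<equiv> carrier A \<times> carrier B"
private abbreviation (input) "F \<equiv> free_space K X"
private abbreviation (input) "N \<equiv> tensor_null K A B"
private abbreviation (input) "T \<equiv> tensor_space K A B"

interpretation F: module K F
  by (rule free_space_module[OF A.R.cring_axioms])

lemma tensor_relators_closed: "tensor_relators K A B \<subseteq> carrier F"
  unfolding tensor_relators_def Let_def
  by (auto intro!: F.minus_closed F.add.m_closed F.smult_closed
      free_gen_closed[OF A.R.cring_axioms] simp del: free_space_ops[OF A.R.cring_axioms])

lemma tensor_null_submodule: "submodule K N F"
  unfolding tensor_null_def by (rule F.span_is_submodule[OF tensor_relators_closed])

lemma tensor_relators_subset_null: "tensor_relators K A B \<subseteq> N"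
  unfolding tensor_null_def by (rule F.in_own_span[OF tensor_relators_closed])

lemma tensor_space_module: "module K T"
  unfolding tensor_space_quotient by (rule quotient_space_module[OF tensor_null_submodule])

interpretation T: module K T by (rule tensor_space_module)

lemma pure_tensor_coset: "pure_tensor K A B a b = N +>\<^bsub>F\<^esub> free_gen K X (a, b)"
  by (simp add: pure_tensor_def Let_def)

lemma free_pair_gen_closed:
  "\<lbrakk>a \<in> carrier A; b \<in> carrier B\<rbrakk> \<Longrightarrow> free_gen K X (a, b) \<in> carrier F"
  by (rule free_gen_closed[OF A.R.cring_axioms]) simp

text \<open>Each of the four families of relators yields one of the four laws of bilinearity, since
  elements of the free space whose difference is a relator have the same coset.\<close>

lemma pure_tensor_bilinear: "bilinear_map K A B T (pure_tensor K A B)"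
proof -
  let ?d = "\<lambda>a b. free_gen K X (a, b)"
  note [simp] = free_pair_gen_closed
  note [simp del] = free_space_ops[OF A.R.cring_axioms]
  note sub = tensor_null_submodule
  have hom: "(\<lambda>x. N +>\<^bsub>F\<^esub> x) \<in> module_hom K F T"
    unfolding tensor_space_quotient by (rule quotient_map_hom[OF sub])
  note add = module_hom_add[OF hom, symmetric] and smult = module_hom_smult[OF hom, symmetric]
  have eq: "N +>\<^bsub>F\<^esub> f = N +>\<^bsub>F\<^esub> g"
    if "f \<ominus>\<^bsub>F\<^esub> g \<in> tensor_relators K A B" "f \<in> carrier F" "g \<in> carrier F" for f g
    using that tensor_relators_subset_null by (intro coset_eqI[OF sub]) auto
  have closed: "N +>\<^bsub>F\<^esub> ?d a b \<in> carrier T" if "a \<in> carrier A" "b \<in> carrier B" for a b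
    using that by (intro module_hom_mem[OF hom]) simp
  show ?thesis
    unfolding pure_tensor_coset
  proof (intro bilinear_mapI module_homI)
    fix a a' b assume *: "a \<in> carrier A" "a' \<in> carrier A" "b \<in> carrier B"
    have "?d (a \<oplus>\<^bsub>A\<^esub> a') b \<ominus>\<^bsub>F\<^esub> (?d a b \<oplus>\<^bsub>F\<^esub> ?d a' b) \<in> tensor_relators K A B"
      unfolding tensor_relators_def Let_def using * by blast
    from eq[OF this] * show "N +>\<^bsub>F\<^esub> ?d (a \<oplus>\<^bsub>A\<^esub> a') b = (N +>\<^bsub>F\<^esub> ?d a b) \<oplus>\<^bsub>T\<^esub> (N +>\<^bsub>F\<^esub> ?d a' b)"
      by (simp add: add)
  next
    fix a b b' assume *: "a \<in> carrier A" "b \<in> carrier B" "b' \<in> carrier B"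
    have "?d a (b \<oplus>\<^bsub>B\<^esub> b') \<ominus>\<^bsub>F\<^esub> (?d a b \<oplus>\<^bsub>F\<^esub> ?d a b') \<in> tensor_relators K A B"
      unfolding tensor_relators_def Let_def using * by blast
    from eq[OF this] * show "N +>\<^bsub>F\<^esub> ?d a (b \<oplus>\<^bsub>B\<^esub> b') = (N +>\<^bsub>F\<^esub> ?d a b) \<oplus>\<^bsub>T\<^esub> (N +>\<^bsub>F\<^esub> ?d a b')"
      by (simp add: add)
  next
    fix k a b assume *: "k \<in> carrier K" "a \<in> carrier A" "b \<in> carrier B"
    have "?d (k \<odot>\<^bsub>A\<^esub> a) b \<ominus>\<^bsub>F\<^esub> k \<odot>\<^bsub>F\<^esub> ?d a b \<in> tensor_relators K A B"
      unfolding tensor_relators_def Let_def using * by blast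
    from eq[OF this] * show "N +>\<^bsub>F\<^esub> ?d (k \<odot>\<^bsub>A\<^esub> a) b = k \<odot>\<^bsub>T\<^esub> (N +>\<^bsub>F\<^esub> ?d a b)"
      by (simp add: smult)
  next
    fix k a b assume *: "a \<in> carrier A" "k \<in> carrier K" "b \<in> carrier B"
    have "?d a (k \<odot>\<^bsub>B\<^esub> b) \<ominus>\<^bsub>F\<^esub> k \<odot>\<^bsub>F\<^esub> ?d a b \<in> tensor_relators K A B"
      unfolding tensor_relators_def Let_def using * by blast
    from eq[OF this] * show "N +>\<^bsub>F\<^esub> ?d a (k \<odot>\<^bsub>B\<^esub> b) = k \<odot>\<^bsub>T\<^esub> (N +>\<^bsub>F\<^esub> ?d a b)"
      by (simp add: smult)
  qed (rule closed; assumption)+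
qed

lemmas pure_tensor_closed = bilinear_mapD(1)[OF pure_tensor_bilinear]
  and pure_tensor_add_right = bilinear_mapD(3)[OF pure_tensor_bilinear]
  and pure_tensor_smult_left = bilinear_mapD(4)[OF pure_tensor_bilinear]
  and pure_tensor_smult_right = bilinear_mapD(5)[OF pure_tensor_bilinear]

text \<open>Every tensor is a finite sum of multiples of pure tensors. The scalar is absorbed into
  the left entry and zero is itself pure, so pure tensors and sums are the only cases left.\<close>

lemma tensor_induct [consumes 1, case_names pure add]:
  assumes "t \<in> carrier T"
    and pure: "\<And>a b. \<lbrakk>a \<in> carrier A; b \<in> carrier B\<rbrakk> \<Longrightarrow> P (pure_tensor K A B a b)"
    and add: "\<And>s t. \<lbrakk>s \<in> carrier T; t \<in> carrier T; P s; P t\<rbrakk> \<Longrightarrow> P (s \<oplus>\<^bsub>T\<^esub> t)"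
  shows "P t"
proof -
  note [simp del] = free_space_ops[OF A.R.cring_axioms]
  have hom: "(\<lambda>x. N +>\<^bsub>F\<^esub> x) \<in> module_hom K F T"
    unfolding tensor_space_quotient by (rule quotient_map_hom[OF tensor_null_submodule])
  obtain f where f: "f \<in> carrier F" "t = N +>\<^bsub>F\<^esub> f"
    using assms(1) unfolding tensor_space_quotient carrier_quotient_space[OF tensor_null_submodule]
    by blast
  have "P (N +>\<^bsub>F\<^esub> f)" using f(1)
  proof (induction rule: free_space_induct[OF A.R.cring_axioms, consumes 1, case_names zero gen])
    case zero
    \<comment> \<open>Zero is recognised as a pure tensor by pulling the scalar zero out of the left
      entry.\<close>
    have "pure_tensor K A B (\<zero>\<^bsub>K\<^esub> \<odot>\<^bsub>A\<^esub> \<zero>\<^bsub>A\<^esub>) \<zero>\<^bsub>B\<^esub> = \<zero>\<^bsub>T\<^esub>"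
      by (subst pure_tensor_smult_left) (simp_all add: pure_tensor_closed)
    then have "N +>\<^bsub>F\<^esub> \<zero>\<^bsub>F\<^esub> = pure_tensor K A B \<zero>\<^bsub>A\<^esub> \<zero>\<^bsub>B\<^esub>"
      using module_hom_zero[OF F.module_axioms T.module_axioms hom] by simp
    then show ?case by (simp add: pure)
  next
    case (gen k x g)
    obtain a b where x: "x = (a, b)" "a \<in> carrier A" "b \<in> carrier B"
      using gen(2) by auto
    have "N +>\<^bsub>F\<^esub> (k \<odot>\<^bsub>F\<^esub> free_gen K X x \<oplus>\<^bsub>F\<^esub> g) =
      pure_tensor K A B (k \<odot>\<^bsub>A\<^esub> a) b \<oplus>\<^bsub>T\<^esub> (N +>\<^bsub>F\<^esub> g)"
      using gen x by (simp add: module_hom_add[OF hom] module_hom_smult[OF hom]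
          free_pair_gen_closed pure_tensor_smult_left pure_tensor_coset[symmetric])
    moreover have "N +>\<^bsub>F\<^esub> g \<in> carrier T"
      using gen by (intro module_hom_mem[OF hom])
    ultimately show ?case
      using gen x by (simp add: add pure pure_tensor_closed)
  qed
  then show ?thesis using f by simp
qed

text \<open>Pure tensors generate. Most later identities are proved by exhibiting both sides as
  linear maps and comparing them on pure tensors.\<close>

lemma tensor_hom_eqI:
  assumes "f \<in> module_hom K T D" "g \<in> module_hom K T D"
    and "\<And>a b. \<lbrakk>a \<in> carrier A; b \<in> carrier B\<rbrakk> \<Longrightarrow>
      f (pure_tensor K A B a b) = g (pure_tensor K A B a b)"
    and "t \<in> carrier T"
  shows "f t = g t"
  using assms(4)
  by (induction rule: tensor_induct)
    (simp_all add: assms(3) module_hom_add[OF assms(1)] module_hom_add[OF assms(2)])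

section \<open>Lifts of bilinear maps\<close>

context
  fixes D :: "('k, 'd) module" and \<phi>
  assumes D: "module K D" and \<phi>: "bilinear_map K A B D \<phi>"
begin

interpretation D: module K D by (rule D)

text \<open>The linear extension of \<phi> to the free space kills every relator by bilinearity,
  hence also their span. It is therefore constant on each coset, and \<open>the_elem\<close>
  extracts this value from the image.\<close>

lemma tensor_lift_coset:
  assumes "f \<in> carrier F"
  shows "tensor_lift K A B D \<phi> (N +>\<^bsub>F\<^esub> f) = free_lift K X D (\<lambda>p. \<phi> (fst p) (snd p)) f"
proof -
  let ?h = "free_lift K X D (\<lambda>p. \<phi> (fst p) (snd p))"
  note [simp del] = free_space_ops[OF A.R.cring_axioms]
  note [simp] = bilinear_mapD[OF \<phi>] free_pair_gen_closed
  have \<psi>: "(\<lambda>p. \<phi> (fst p) (snd p)) \<in> X \<rightarrow> carrier D" by auto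
  have hom: "?h \<in> module_hom K F D"
    by (rule free_lift_hom[OF A.R.cring_axioms D \<psi>])
  interpret h: mod_hom K F D ?h
    using hom F.module_axioms D by (simp add: mod_hom_def mod_hom_axioms_def)
  have gen: "?h (free_gen K X (a, b)) = \<phi> a b" if "a \<in> carrier A" "b \<in> carrier B" for a b
    using that free_lift_gen[OF A.R.cring_axioms D \<psi>, of "(a, b)"] by simp
  have "tensor_relators K A B \<subseteq> h.ker"
    unfolding tensor_relators_def Let_def h.ker_def
    by (auto simp: gen D.r_neg D.minus_eq)
  then have "N \<subseteq> h.ker"
    unfolding tensor_null_def by (rule F.span_is_subset[OF _ h.ker_is_submodule])
  then have "?h y = \<zero>\<^bsub>D\<^esub>" if "y \<in> N" for y
    using that by (auto simp: h.ker_def)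
  then have "?h ` (N +>\<^bsub>F\<^esub> f) = {?h f}"
    using module_hom_image_coset[OF tensor_null_submodule D hom] assms by blast
  then show ?thesis
    unfolding tensor_lift_def free_lift_def by simp
qed

text \<open>Sums and multiples of cosets are computed on representatives, and there the lift is the
  linear extension of \<phi> to the free space.\<close>

lemma tensor_lift_hom: "tensor_lift K A B D \<phi> \<in> module_hom K T D"
proof -
  note [simp del] = free_space_ops[OF A.R.cring_axioms]
  note sub = tensor_null_submodule
  have \<psi>: "(\<lambda>p. \<phi> (fst p) (snd p)) \<in> X \<rightarrow> carrier D"
    using bilinear_mapD(1)[OF \<phi>] by auto
  note hom = free_lift_hom[OF A.R.cring_axioms D \<psi>]
  show ?thesis
    unfolding tensor_space_quotient
    by (rule module_homI)
      (auto simp: carrier_quotient_space[OF sub] quotient_space_add[OF sub]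
        quotient_space_smult[OF sub] tensor_lift_coset
        module_hom_add[OF hom] module_hom_smult[OF hom] intro: module_hom_mem[OF hom])
qed

lemma tensor_lift_pure:
  "\<lbrakk>a \<in> carrier A; b \<in> carrier B\<rbrakk> \<Longrightarrow>
    tensor_lift K A B D \<phi> (pure_tensor K A B a b) = \<phi> a b"
  using free_lift_gen[OF A.R.cring_axioms D, of "\<lambda>p. \<phi> (fst p) (snd p)" X "(a, b)"]
    bilinear_mapD(1)[OF \<phi>]
  by (simp add: pure_tensor_coset tensor_lift_coset free_pair_gen_closed Pi_iff)

end

end

section \<open>Tensor products of linear maps\<close>

lemma module_hom_add_closed:
  assumes "module K M" "module K N" "f \<in> module_hom K M N" "g \<in> module_hom K M N"
  shows "(\<lambda>x. f x \<oplus>\<^bsub>N\<^esub> g x) \<in> module_hom K M N"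
proof -
  interpret M: module K M by fact
  interpret N: module K N by fact
  note [simp] = module_hom_add[OF assms(3)] module_hom_add[OF assms(4)]
    module_hom_smult[OF assms(3)] module_hom_smult[OF assms(4)]
    module_hom_mem[OF assms(3)] module_hom_mem[OF assms(4)]
  show ?thesis
    by (rule module_homI) (simp_all add: N.a_ac N.smult_r_distr)
qed

text \<open>Commutativity of the scalars enters here: \<open>k\<close> has to change places with the
  scalar pulled out of the argument.\<close>

lemma module_hom_smult_closed:
  assumes "module K M" "module K N" "f \<in> module_hom K M N" "k \<in> carrier K"
  shows "(\<lambda>x. k \<odot>\<^bsub>N\<^esub> f x) \<in> module_hom K M N"
proof -
  interpret M: module K M by fact
  interpret N: module K N by fact
  note [simp] = module_hom_add[OF assms(3)] module_hom_smult[OF assms(3)] module_hom_mem[OF assms(3)]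
  show ?thesis
    using assms(4) by (intro module_homI)
      (simp_all add: N.smult_r_distr N.smult_assoc1[symmetric] M.R.m_comm)
qed

lemma module_hom_finsum_closed:
  assumes "module K M" "module K N" "\<And>i. i \<in> I \<Longrightarrow> h i \<in> module_hom K M N"
  shows "(\<lambda>x. \<Oplus>\<^bsub>N\<^esub>i\<in>I. h i x) \<in> module_hom K M N"
proof -
  interpret M: module K M by fact
  interpret N: module K N by fact
  have [simp]: "(\<lambda>i. h i x) \<in> I \<rightarrow> carrier N" if "x \<in> carrier M" for x
    using that assms(3) by (auto intro: module_hom_mem)
  show ?thesis
  proof (rule module_homI)
    fix x y assume xy: "x \<in> carrier M" "y \<in> carrier M"
    have "(\<Oplus>\<^bsub>N\<^esub>i\<in>I. h i (x \<oplus>\<^bsub>M\<^esub> y)) = (\<Oplus>\<^bsub>N\<^esub>i\<in>I. h i x \<oplus>\<^bsub>N\<^esub> h i y)"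
      using xy by (intro N.finsum_cong')
        (auto simp: module_hom_add[OF assms(3)] intro: module_hom_mem[OF assms(3)])
    then show "(\<Oplus>\<^bsub>N\<^esub>i\<in>I. h i (x \<oplus>\<^bsub>M\<^esub> y)) = (\<Oplus>\<^bsub>N\<^esub>i\<in>I. h i x) \<oplus>\<^bsub>N\<^esub> (\<Oplus>\<^bsub>N\<^esub>i\<in>I. h i y)"
      using xy by (simp add: N.finsum_addf)
  next
    fix k x assume kx: "k \<in> carrier K" "x \<in> carrier M"
    have "(\<Oplus>\<^bsub>N\<^esub>i\<in>I. h i (k \<odot>\<^bsub>M\<^esub> x)) = (\<Oplus>\<^bsub>N\<^esub>i\<in>I. k \<odot>\<^bsub>N\<^esub> h i x)"
      using kx by (intro N.finsum_cong')
        (auto simp: module_hom_smult[OF assms(3)] intro: module_hom_mem[OF assms(3)])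
    then show "(\<Oplus>\<^bsub>N\<^esub>i\<in>I. h i (k \<odot>\<^bsub>M\<^esub> x)) = k \<odot>\<^bsub>N\<^esub> (\<Oplus>\<^bsub>N\<^esub>i\<in>I. h i x)"
      using kx by (simp add: N.finsum_smult)
  qed simp
qed

lemma bilinear_map_left_hom: "\<lbrakk>bilinear_map K A B D \<phi>; b \<in> carrier B\<rbrakk> \<Longrightarrow> (\<lambda>a. \<phi> a b) \<in> module_hom K A D"
  and bilinear_map_right_hom: "\<lbrakk>bilinear_map K A B D \<phi>; a \<in> carrier A\<rbrakk> \<Longrightarrow> \<phi> a \<in> module_hom K B D"
  by (simp_all add: bilinear_map_def)

lemma bilinear_map_comp:
  assumes "bilinear_map K C D E \<phi>" "f \<in> module_hom K A C" "g \<in> module_hom K B D"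
    "module K A" "module K B"
  shows "bilinear_map K A B E (\<lambda>a b. \<phi> (f a) (g b))"
proof -
  interpret A: module K A by fact
  interpret B: module K B by fact
  note [simp] = bilinear_mapD[OF assms(1)] module_hom_mem[OF assms(2)] module_hom_mem[OF assms(3)]
    module_hom_add[OF assms(2)] module_hom_add[OF assms(3)]
    module_hom_smult[OF assms(2)] module_hom_smult[OF assms(3)]
  show ?thesis by (intro bilinear_mapI module_homI) simp_all
qed

lemma ground_space_module: "cring K \<Longrightarrow> module K (ground_space K)"
proof -
  assume "cring K"
  then interpret cring K .
  show ?thesis
    by (rule module_criteria)
      (auto simp: ground_space_def a_ac m_assoc l_distr r_distr cring_axioms intro: r_neg)
qed

section \<open>Functoriality of the tensor product\<close>

lemma tensor_map_bilinear:
  assumes "module K A" "module K B" "module K C" "module K D"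
    "f \<in> module_hom K A C" "g \<in> module_hom K B D"
  shows "bilinear_map K A B (tensor_space K C D) (\<lambda>a b. pure_tensor K C D (f a) (g b))"
  using assms by (intro bilinear_map_comp[OF pure_tensor_bilinear])

lemma tensor_map_hom:
  assumes "module K A" "module K B" "module K C" "module K D"
    "f \<in> module_hom K A C" "g \<in> module_hom K B D"
  shows "tensor_map K A B C D f g \<in> module_hom K (tensor_space K A B) (tensor_space K C D)"
  unfolding tensor_map_def
  using assms by (intro tensor_lift_hom tensor_space_module tensor_map_bilinear)

lemma tensor_map_pure:
  assumes "module K A" "module K B" "module K C" "module K D"
    "f \<in> module_hom K A C" "g \<in> module_hom K B D" "a \<in> carrier A" "b \<in> carrier B"
  shows "tensor_map K A B C D f g (pure_tensor K A B a b) = pure_tensor K C D (f a) (g b)"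
  unfolding tensor_map_def
  using assms by (intro tensor_lift_pure tensor_space_module tensor_map_bilinear)

text \<open>Both sides send \<open>a \<otimes> b\<close> to
  \<open>f' (f a) \<otimes> g' (g b)\<close>.\<close>

lemma tensor_map_comp:
  assumes mods: "module K A" "module K B" "module K C" "module K D" "module K E" "module K F"
    and homs: "f \<in> module_hom K A C" "g \<in> module_hom K B D"
      "f' \<in> module_hom K C E" "g' \<in> module_hom K D F"
    and t: "t \<in> carrier (tensor_space K A B)"
  shows "tensor_map K C D E F f' g' (tensor_map K A B C D f g t) =
    tensor_map K A B E F (f' \<circ> f) (g' \<circ> g) t"
proof -
  note comps = module_hom_comp[OF homs(3,1)] module_hom_comp[OF homs(4,2)]
  have "(tensor_map K C D E F f' g' \<circ> tensor_map K A B C D f g) t =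
    tensor_map K A B E F (f' \<circ> f) (g' \<circ> g) t"
  proof (rule tensor_hom_eqI[OF mods(1,2) _ _ _ t])
    show "tensor_map K C D E F f' g' \<circ> tensor_map K A B C D f g
      \<in> module_hom K (tensor_space K A B) (tensor_space K E F)"
      using mods homs by (intro module_hom_comp[OF tensor_map_hom tensor_map_hom])
    show "tensor_map K A B E F (f' \<circ> f) (g' \<circ> g)
      \<in> module_hom K (tensor_space K A B) (tensor_space K E F)"
      using mods comps by (intro tensor_map_hom)
    fix a b assume "a \<in> carrier A" "b \<in> carrier B"
    then show "(tensor_map K C D E F f' g' \<circ> tensor_map K A B C D f g) (pure_tensor K A B a b) =
      tensor_map K A B E F (f' \<circ> f) (g' \<circ> g) (pure_tensor K A B a b)"
      using mods homs comps by (simp add: tensor_map_pure module_hom_mem[of _ K])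
  qed
  then show ?thesis by simp
qed

text \<open>Linear maps that agree on carriers may still differ as HOL functions. In such cases this
  lemma takes the place of rewriting with an equation between the maps.\<close>

lemma tensor_map_cong:
  assumes mods: "module K A" "module K B" "module K C" "module K D"
    and homs: "f \<in> module_hom K A C" "g \<in> module_hom K B D"
    and eqs: "\<And>a. a \<in> carrier A \<Longrightarrow> f a = f' a" "\<And>b. b \<in> carrier B \<Longrightarrow> g b = g' b"
    and t: "t \<in> carrier (tensor_space K A B)"
  shows "tensor_map K A B C D f g t = tensor_map K A B C D f' g' t"
proof (rule tensor_hom_eqI[OF mods(1,2) _ _ _ t])
  have homs': "f' \<in> module_hom K A C" "g' \<in> module_hom K B D"
    using homs module_hom_cong[of A f f' K C] module_hom_cong[of B g g' K D] eqs mods by auto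
  show "tensor_map K A B C D f' g' \<in> module_hom K (tensor_space K A B) (tensor_space K C D)"
    using mods homs' by (intro tensor_map_hom)
  show "tensor_map K A B C D f g (pure_tensor K A B a b) = tensor_map K A B C D f' g' (pure_tensor K A B a b)"
    if "a \<in> carrier A" "b \<in> carrier B" for a b
    using that eqs mods homs homs' by (simp add: tensor_map_pure)
qed (use mods homs in \<open>intro tensor_map_hom\<close>)

lemma tensor_map_id:
  assumes "module K A" "module K B" "t \<in> carrier (tensor_space K A B)"
  shows "tensor_map K A B A B id id t = t"
proof -
  have "tensor_map K A B A B id id t = id t"
  proof (rule tensor_hom_eqI[OF assms(1,2) _ module_hom_id _ assms(3)])
    show "tensor_map K A B A B id id \<in> module_hom K (tensor_space K A B) (tensor_space K A B)"
      using assms by (intro tensor_map_hom module_hom_id)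
    fix a b assume "a \<in> carrier A" "b \<in> carrier B"
    then show "tensor_map K A B A B id id (pure_tensor K A B a b) = id (pure_tensor K A B a b)"
      using assms by (simp add: tensor_map_pure module_hom_id)
  qed
  then show ?thesis by simp
qed

text \<open>For fixed \<open>c\<close> the lift is linear in \<open>t\<close> by construction. For
  fixed \<open>t\<close>, linearity in \<open>c\<close> is an equality between two linear maps
  evaluated at \<open>t\<close>, so pure tensors suffice as a test.\<close>

lemma tensor_lift_bilinear:
  assumes mods: "module K A" "module K B" "module K C" "module K D"
    and bil: "\<And>c. c \<in> carrier C \<Longrightarrow> bilinear_map K A B D (\<lambda>a b. \<phi> a b c)"
    and hom: "\<And>a b. \<lbrakk>a \<in> carrier A; b \<in> carrier B\<rbrakk> \<Longrightarrow> \<phi> a b \<in> module_hom K C D"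
  shows "bilinear_map K (tensor_space K A B) C D (\<lambda>t c. tensor_lift K A B D (\<lambda>a b. \<phi> a b c) t)"
proof -
  interpret C: module K C by fact
  interpret D: module K D by fact
  note lift = tensor_lift_hom[OF mods(1,2,4) bil]
  note pure = tensor_lift_pure[OF mods(1,2,4) bil]
  show ?thesis
  proof (rule bilinear_mapI)
    fix t assume t: "t \<in> carrier (tensor_space K A B)"
    show "(\<lambda>c. tensor_lift K A B D (\<lambda>a b. \<phi> a b c) t) \<in> module_hom K C D"
    proof (rule module_homI)
      fix c c' assume c: "c \<in> carrier C" "c' \<in> carrier C"
      show "tensor_lift K A B D (\<lambda>a b. \<phi> a b (c \<oplus>\<^bsub>C\<^esub> c')) t =
        tensor_lift K A B D (\<lambda>a b. \<phi> a b c) t \<oplus>\<^bsub>D\<^esub> tensor_lift K A B D (\<lambda>a b. \<phi> a b c') t"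
        using c by (intro tensor_hom_eqI[OF mods(1,2) lift _ _ t] module_hom_add_closed
            tensor_space_module mods lift) (simp_all add: pure module_hom_add[OF hom])
    next
      fix k c assume c: "k \<in> carrier K" "c \<in> carrier C"
      show "tensor_lift K A B D (\<lambda>a b. \<phi> a b (k \<odot>\<^bsub>C\<^esub> c)) t =
        k \<odot>\<^bsub>D\<^esub> tensor_lift K A B D (\<lambda>a b. \<phi> a b c) t"
        using c by (intro tensor_hom_eqI[OF mods(1,2) lift _ _ t] module_hom_smult_closed
            tensor_space_module mods lift) (simp_all add: pure module_hom_smult[OF hom])
    qed (rule module_hom_mem[OF lift t])
  qed (rule lift)
qed

section \<open>Reassociation of triple tensor products\<close>

context
  fixes K :: "'k ring" and A :: "('k, 'a) module" and B :: "('k, 'b) module"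
    and C :: "('k, 'c) module"
  assumes A: "module K A" and B: "module K B" and C: "module K C"
begin

lemma tensor_assoc_inner_bilinear:
  assumes "c \<in> carrier C"
  shows "bilinear_map K A B (tensor_space K A (tensor_space K B C))
    (\<lambda>a b. pure_tensor K A (tensor_space K B C) a (pure_tensor K B C b c))"
  using bilinear_map_comp[OF pure_tensor_bilinear[OF A tensor_space_module[OF B C]] module_hom_id
    bilinear_map_left_hom[OF pure_tensor_bilinear[OF B C] assms] A B]
  by simp

lemma tensor_assoc_bilinear:
  "bilinear_map K (tensor_space K A B) C (tensor_space K A (tensor_space K B C))
    (\<lambda>t c. tensor_lift K A B (tensor_space K A (tensor_space K B C))
      (\<lambda>a b. pure_tensor K A (tensor_space K B C) a (pure_tensor K B C b c)) t)"
proof (rule tensor_lift_bilinear[OF A B C])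
  show "module K (tensor_space K A (tensor_space K B C))"
    by (intro tensor_space_module A B C)
  fix a b assume "a \<in> carrier A" "b \<in> carrier B"
  then show "(\<lambda>c. pure_tensor K A (tensor_space K B C) a (pure_tensor K B C b c))
    \<in> module_hom K C (tensor_space K A (tensor_space K B C))"
    using module_hom_comp[OF bilinear_map_right_hom[OF pure_tensor_bilinear[OF A tensor_space_module[OF B C]]]
       bilinear_map_right_hom[OF pure_tensor_bilinear[OF B C]]]
    by (simp add: o_def)
qed (rule tensor_assoc_inner_bilinear)

lemma tensor_assoc_hom:
  "tensor_assoc K A B C \<in> module_hom K (tensor_space K (tensor_space K A B) C)
     (tensor_space K A (tensor_space K B C))"
  unfolding tensor_assoc_def Let_def
  by (intro tensor_lift_hom tensor_space_module A B C tensor_assoc_bilinear)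

lemma tensor_assoc_pure:
  assumes "a \<in> carrier A" "b \<in> carrier B" "c \<in> carrier C"
  shows "tensor_assoc K A B C (pure_tensor K (tensor_space K A B) C (pure_tensor K A B a b) c) =
    pure_tensor K A (tensor_space K B C) a (pure_tensor K B C b c)"
proof -
  have "tensor_assoc K A B C (pure_tensor K (tensor_space K A B) C (pure_tensor K A B a b) c) =
    tensor_lift K A B (tensor_space K A (tensor_space K B C))
      (\<lambda>a b. pure_tensor K A (tensor_space K B C) a (pure_tensor K B C b c)) (pure_tensor K A B a b)"
    unfolding tensor_assoc_def Let_def
    using assms by (intro tensor_lift_pure tensor_space_module A B C tensor_assoc_bilinear
        pure_tensor_closed)
  also have "\<dots> = pure_tensor K A (tensor_space K B C) a (pure_tensor K B C b c)"
    using assms by (intro tensor_lift_pure tensor_space_module A B C tensor_assoc_inner_bilinear)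
  finally show ?thesis .
qed

text \<open>Two rounds of comparison: the outer tensor product reduces the claim to
  \<open>s \<otimes> c\<close>; for fixed \<open>c\<close> both sides are linear in
  \<open>s\<close>, which reduces it to \<open>s = a \<otimes> b\<close>.\<close>

lemma tensor3_hom_eqI:
  assumes f: "f \<in> module_hom K (tensor_space K (tensor_space K A B) C) D"
    and g: "g \<in> module_hom K (tensor_space K (tensor_space K A B) C) D"
    and D: "module K D"
    and eq: "\<And>a b c. \<lbrakk>a \<in> carrier A; b \<in> carrier B; c \<in> carrier C\<rbrakk> \<Longrightarrow>
      f (pure_tensor K (tensor_space K A B) C (pure_tensor K A B a b) c) =
      g (pure_tensor K (tensor_space K A B) C (pure_tensor K A B a b) c)"
    and t: "t \<in> carrier (tensor_space K (tensor_space K A B) C)"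
  shows "f t = g t"
proof (rule tensor_hom_eqI[OF tensor_space_module[OF A B] C f g _ t])
  fix s c assume s: "s \<in> carrier (tensor_space K A B)" and c: "c \<in> carrier C"
  note p = bilinear_map_left_hom[OF pure_tensor_bilinear[OF tensor_space_module[OF A B] C] c]
  have "(f \<circ> (\<lambda>s. pure_tensor K (tensor_space K A B) C s c)) s =
    (g \<circ> (\<lambda>s. pure_tensor K (tensor_space K A B) C s c)) s"
    by (rule tensor_hom_eqI[OF A B module_hom_comp[OF f p] module_hom_comp[OF g p] _ s])
      (simp add: eq c)
  then show "f (pure_tensor K (tensor_space K A B) C s c) = g (pure_tensor K (tensor_space K A B) C s c)"
    by simp
qed

end

text \<open>Both routes send \<open>(a \<otimes> b) \<otimes> c\<close> to
  \<open>f a \<otimes> (g b \<otimes> h c)\<close>.\<close>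

lemma tensor_assoc_natural:
  assumes mods: "module K A" "module K B" "module K C" "module K A'" "module K B'" "module K C'"
    and homs: "f \<in> module_hom K A A'" "g \<in> module_hom K B B'" "h \<in> module_hom K C C'"
    and t: "t \<in> carrier (tensor_space K (tensor_space K A B) C)"
  shows "tensor_assoc K A' B' C' (tensor_map K (tensor_space K A B) C (tensor_space K A' B') C'
      (tensor_map K A B A' B' f g) h t) =
    tensor_map K A (tensor_space K B C) A' (tensor_space K B' C') f
      (tensor_map K B C B' C' g h) (tensor_assoc K A B C t)"
proof -
  note hom = tensor_map_hom[OF mods(1,2,4,5) homs(1,2)] tensor_map_hom[OF mods(2,3,5,6) homs(2,3)]
  note intros = tensor_assoc_hom tensor_map_hom tensor_space_module mods homs
  have "(tensor_assoc K A' B' C' \<circ> tensor_map K (tensor_space K A B) C (tensor_space K A' B') C'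
      (tensor_map K A B A' B' f g) h) t =
    (tensor_map K A (tensor_space K B C) A' (tensor_space K B' C') f
      (tensor_map K B C B' C' g h) \<circ> tensor_assoc K A B C) t"
  proof (rule tensor3_hom_eqI[OF mods(1-3) _ _ _ _ t])
    show "tensor_assoc K A' B' C' \<circ> tensor_map K (tensor_space K A B) C (tensor_space K A' B') C'
        (tensor_map K A B A' B' f g) h
      \<in> module_hom K (tensor_space K (tensor_space K A B) C) (tensor_space K A' (tensor_space K B' C'))"
      by (intro module_hom_comp[OF tensor_assoc_hom tensor_map_hom] intros)
    show "tensor_map K A (tensor_space K B C) A' (tensor_space K B' C') f
        (tensor_map K B C B' C' g h) \<circ> tensor_assoc K A B C
      \<in> module_hom K (tensor_space K (tensor_space K A B) C) (tensor_space K A' (tensor_space K B' C'))"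
      by (intro module_hom_comp[OF tensor_map_hom tensor_assoc_hom] intros)
    show "module K (tensor_space K A' (tensor_space K B' C'))" by (intro intros)
  qed (use mods homs hom in \<open>simp add: tensor_map_pure tensor_assoc_pure tensor_space_module
      pure_tensor_closed module_hom_mem[of _ K]\<close>)
  then show ?thesis by simp
qed

section \<open>Contraction with a functional\<close>

text \<open>The operator \<open>\<sim>(I \<otimes> \<chi>)\<close> behind the coaction, isolated
  from the comultiplication so that its exchange with other tensor maps can be treated on its
  own.\<close>

definition tensor_contract ::
  "'k ring \<Rightarrow> ('k, 'a) module \<Rightarrow> ('k, 'b) module \<Rightarrow> ('b \<Rightarrow> 'k) \<Rightarrow> ('k, 'a, 'b) tensor \<Rightarrow> 'a" where
  "tensor_contract K A B \<chi> t =
     tensor_runit K A (tensor_map K A B A (ground_space K) id \<chi> t)"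

lemma module_cring: "module K A \<Longrightarrow> cring K"
  by (simp add: module_def)

section \<open>The right unit map\<close>

lemma tensor_runit_bilinear:
  assumes "module K A"
  shows "bilinear_map K A (ground_space K) A (\<lambda>a k. k \<odot>\<^bsub>A\<^esub> a)"
proof -
  interpret module K A by fact
  show ?thesis
    by (intro bilinear_mapI module_homI)
      (simp_all add: ground_space_def smult_l_distr smult_r_distr smult_assoc1[symmetric] m_comm)
qed

lemma tensor_runit_hom:
  "module K A \<Longrightarrow> tensor_runit K A \<in> module_hom K (tensor_space K A (ground_space K)) A"
  unfolding tensor_runit_def
  by (intro tensor_lift_hom tensor_runit_bilinear ground_space_module module_cring)

lemma tensor_runit_pure:
  "\<lbrakk>module K A; a \<in> carrier A; k \<in> carrier K\<rbrakk> \<Longrightarrow>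
    tensor_runit K A (pure_tensor K A (ground_space K) a k) = k \<odot>\<^bsub>A\<^esub> a"
  unfolding tensor_runit_def
  by (intro tensor_lift_pure tensor_runit_bilinear ground_space_module module_cring)
    (simp_all add: ground_space_def)

text \<open>The counit law of a coalgebra is stated in \<open>A\<close>, after
  \<open>tensor_runit\<close>; that of a comodule is stated in \<open>A \<otimes> K\<close>, with
  second entry one. This identity translates the first form into the second.\<close>

lemma tensor_runit_inverse:
  assumes A: "module K A" and t: "t \<in> carrier (tensor_space K A (ground_space K))"
  shows "pure_tensor K A (ground_space K) (tensor_runit K A t) \<one>\<^bsub>K\<^esub> = t"
proof -
  interpret A: module K A by fact
  have G: "module K (ground_space K)" by (intro ground_space_module module_cring[OF A])
  have one: "\<one>\<^bsub>K\<^esub> \<in> carrier (ground_space K)" by (simp add: ground_space_def)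
  have "((\<lambda>a. pure_tensor K A (ground_space K) a \<one>\<^bsub>K\<^esub>) \<circ> tensor_runit K A) t = id t"
  proof (rule tensor_hom_eqI[OF A G _ module_hom_id _ t])
    show "(\<lambda>a. pure_tensor K A (ground_space K) a \<one>\<^bsub>K\<^esub>) \<circ> tensor_runit K A
      \<in> module_hom K (tensor_space K A (ground_space K)) (tensor_space K A (ground_space K))"
      by (intro module_hom_comp[OF _ tensor_runit_hom] A
          bilinear_map_left_hom[OF pure_tensor_bilinear[OF A G] one])
    fix a k assume a: "a \<in> carrier A" and k: "k \<in> carrier (ground_space K)"
    then have "k \<in> carrier K" "k \<odot>\<^bsub>ground_space K\<^esub> \<one>\<^bsub>K\<^esub> = k" by (auto simp: ground_space_def)
    \<comment> \<open>The scalar crosses the tensor sign: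
      \<open>(k a) \<otimes> 1 = a \<otimes> (k 1)\<close>.\<close>
    then show "((\<lambda>a. pure_tensor K A (ground_space K) a \<one>\<^bsub>K\<^esub>) \<circ> tensor_runit K A)
        (pure_tensor K A (ground_space K) a k) = id (pure_tensor K A (ground_space K) a k)"
      using a one by (simp add: tensor_runit_pure A pure_tensor_smult_left[OF A G]
          pure_tensor_smult_right[OF A G, symmetric])
  qed
  then show ?thesis by simp
qed

section \<open>Naturality of contraction\<close>

context
  fixes K :: "'k ring" and B :: "('k, 'b) module" and \<chi> :: "'b \<Rightarrow> 'k"
  assumes B: "module K B" and \<chi>: "\<chi> \<in> module_hom K B (ground_space K)"
begin

lemma functional_closed: "b \<in> carrier B \<Longrightarrow> \<chi> b \<in> carrier K"
  using module_hom_mem[OF \<chi>] by (simp add: ground_space_def)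

lemma tensor_contract_hom:
  "module K A \<Longrightarrow> tensor_contract K A B \<chi> \<in> module_hom K (tensor_space K A B) A"
  using module_hom_comp[OF tensor_runit_hom tensor_map_hom[OF _ B _ _ module_hom_id \<chi>]]
  by (simp add: o_def tensor_contract_def[abs_def] ground_space_module module_cring)

lemma tensor_contract_pure:
  assumes "module K A" "a \<in> carrier A" "b \<in> carrier B"
  shows "tensor_contract K A B \<chi> (pure_tensor K A B a b) = \<chi> b \<odot>\<^bsub>A\<^esub> a"
  using assms B \<chi> by (simp add: tensor_contract_def tensor_map_pure module_hom_id ground_space_module
      module_cring[OF B] tensor_runit_pure functional_closed)

text \<open>The map acts on the left factor and the functional on the right one, so on pure tensors
  both sides give \<open>\<chi> b\<close> times \<open>f a\<close>.\<close>

lemma tensor_contract_natural: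
  assumes A: "module K A" "module K A'" and f: "f \<in> module_hom K A A'"
    and t: "t \<in> carrier (tensor_space K A B)"
  shows "f (tensor_contract K A B \<chi> t) =
    tensor_contract K A' B \<chi> (tensor_map K A B A' B f id t)"
proof -
  have "(f \<circ> tensor_contract K A B \<chi>) t =
    (tensor_contract K A' B \<chi> \<circ> tensor_map K A B A' B f id) t"
  proof (rule tensor_hom_eqI[OF A(1) B _ _ _ t])
    show "f \<circ> tensor_contract K A B \<chi> \<in> module_hom K (tensor_space K A B) A'"
      by (intro module_hom_comp[OF f] tensor_contract_hom A)
    show "tensor_contract K A' B \<chi> \<circ> tensor_map K A B A' B f id \<in> module_hom K (tensor_space K A B) A'"
      by (intro module_hom_comp[OF tensor_contract_hom tensor_map_hom] A B f module_hom_id)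
    fix a b assume "a \<in> carrier A" "b \<in> carrier B"
    then show "(f \<circ> tensor_contract K A B \<chi>) (pure_tensor K A B a b) =
      (tensor_contract K A' B \<chi> \<circ> tensor_map K A B A' B f id) (pure_tensor K A B a b)"
      using A f by (simp add: tensor_contract_pure tensor_map_pure B module_hom_id
          module_hom_mem[OF f] module_hom_smult[OF f] functional_closed)
  qed
  then show ?thesis by simp
qed

text \<open>On \<open>(a \<otimes> d) \<otimes> b\<close> both sides are \<open>\<chi> b\<close>
  times \<open>a \<otimes> d\<close>: the scalar may be carried into the entry \<open>d\<close>,
  where contracting \<open>D \<otimes> B\<close> leaves it.\<close>

lemma tensor_contract_assoc:
  assumes mods: "module K A" "module K D"
    and t: "t \<in> carrier (tensor_space K (tensor_space K A D) B)"
  shows "tensor_contract K (tensor_space K A D) B \<chi> t =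
    tensor_map K A (tensor_space K D B) A D id (tensor_contract K D B \<chi>) (tensor_assoc K A D B t)"
proof -
  note hom = tensor_contract_hom[OF mods(2)]
  have "tensor_contract K (tensor_space K A D) B \<chi> t =
    (tensor_map K A (tensor_space K D B) A D id (tensor_contract K D B \<chi>) \<circ> tensor_assoc K A D B) t"
  proof (rule tensor3_hom_eqI[OF mods B _ _ _ _ t])
    show "tensor_contract K (tensor_space K A D) B \<chi>
      \<in> module_hom K (tensor_space K (tensor_space K A D) B) (tensor_space K A D)"
      by (intro tensor_contract_hom tensor_space_module mods)
    show "tensor_map K A (tensor_space K D B) A D id (tensor_contract K D B \<chi>) \<circ> tensor_assoc K A D B
      \<in> module_hom K (tensor_space K (tensor_space K A D) B) (tensor_space K A D)"
      by (intro module_hom_comp[OF tensor_map_hom tensor_assoc_hom] tensor_space_module mods B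
          module_hom_id hom)
    show "module K (tensor_space K A D)" by (intro tensor_space_module mods)
    fix a d b assume "a \<in> carrier A" "d \<in> carrier D" "b \<in> carrier B"
    then show "tensor_contract K (tensor_space K A D) B \<chi>
        (pure_tensor K (tensor_space K A D) B (pure_tensor K A D a d) b) =
      (tensor_map K A (tensor_space K D B) A D id (tensor_contract K D B \<chi>) \<circ> tensor_assoc K A D B)
        (pure_tensor K (tensor_space K A D) B (pure_tensor K A D a d) b)"
      by (simp add: mods B hom tensor_contract_pure tensor_map_pure tensor_assoc_pure module_hom_id
        tensor_space_module pure_tensor_closed pure_tensor_smult_right functional_closed)
  qed
  then show ?thesis by simp
qed

end

section \<open>Dual frames\<close>

text \<open>A finite system with the reconstruction formula of a basis and its dual basis. The index
  type is left free so that pairs can index the system of a tensor product.\<close>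

definition dual_frame ::
  "'k ring \<Rightarrow> ('k, 'a) module \<Rightarrow> 'i set \<Rightarrow> ('i \<Rightarrow> 'a) \<Rightarrow> ('i \<Rightarrow> 'a \<Rightarrow> 'k) \<Rightarrow> bool" where
  "dual_frame K D I d \<delta> \<longleftrightarrow> finite I \<and>
     (\<forall>i\<in>I. d i \<in> carrier D \<and> \<delta> i \<in> module_hom K D (ground_space K)) \<and>
     (\<forall>x\<in>carrier D. (\<Oplus>\<^bsub>D\<^esub>i\<in>I. \<delta> i x \<odot>\<^bsub>D\<^esub> d i) = x)"

lemma dual_frameD:
  assumes "dual_frame K D I d \<delta>"
  shows "finite I" "\<And>i. i \<in> I \<Longrightarrow> d i \<in> carrier D"
    and "\<And>i. i \<in> I \<Longrightarrow> \<delta> i \<in> module_hom K D (ground_space K)"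
    and "\<And>x. x \<in> carrier D \<Longrightarrow> (\<Oplus>\<^bsub>D\<^esub>i\<in>I. \<delta> i x \<odot>\<^bsub>D\<^esub> d i) = x"
    and "\<And>i x. \<lbrakk>i \<in> I; x \<in> carrier D\<rbrakk> \<Longrightarrow> \<delta> i x \<in> carrier K"
proof -
  show \<delta>: "\<delta> i \<in> module_hom K D (ground_space K)" if "i \<in> I" for i
    using assms that by (simp add: dual_frame_def)
  show "\<delta> i x \<in> carrier K" if "i \<in> I" "x \<in> carrier D" for i x
    using module_hom_mem[OF \<delta>] that by (simp add: ground_space_def)
qed (use assms in \<open>auto simp: dual_frame_def\<close>)

lemma functional_smult_hom:
  fixes K :: "'k ring" and D :: "('k, 'd) module"
  assumes "module K D" "d \<in> carrier D" "\<delta> \<in> module_hom K M (ground_space K)"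
  shows "(\<lambda>x. \<delta> x \<odot>\<^bsub>D\<^esub> d) \<in> module_hom K M D"
  using module_hom_comp[OF bilinear_map_right_hom[OF tensor_runit_bilinear[OF assms(1)] assms(2)] assms(3)]
  by (simp add: o_def)

text \<open>The reconstruction map \<open>?h\<close> is linear and fixes each \<open>e j\<close> by
  duality. As these vectors span the space, it fixes everything.\<close>

lemma basis_dual_frame:
  assumes D: "vectorspace K D" and "is_basis_family K D n e" "is_dual_basis_family K D n e g"
  shows "dual_frame K D {1..n} e g"
proof -
  interpret D: vectorspace K D by fact
  let ?I = "{1..n}"
  let ?h = "\<lambda>x. \<Oplus>\<^bsub>D\<^esub>i\<in>?I. g i x \<odot>\<^bsub>D\<^esub> e i"
  have inj: "inj_on e ?I" and e: "e ` ?I \<subseteq> carrier D" and span: "D.span (e ` ?I) = carrier D"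
    using assms(2) by (auto simp: is_basis_family_def D.basis_def)
  have eI: "e i \<in> carrier D" if "i \<in> ?I" for i using e that by auto
  have g: "g i \<in> module_hom K D (ground_space K)" if "i \<in> ?I" for i
    using assms(3) that by (simp add: is_dual_basis_family_def linear_map_iff)
  have h: "?h \<in> module_hom K D D"
    using eI g by (intro module_hom_finsum_closed functional_smult_hom D.module_axioms)
  have he: "?h (e j) = e j" if "j \<in> ?I" for j
  proof -
    have "?h (e j) = (\<Oplus>\<^bsub>D\<^esub>i\<in>?I. if j = i then e i else \<zero>\<^bsub>D\<^esub>)"
      using that assms(3) eI by (intro D.finsum_cong') (auto simp: is_dual_basis_family_def)
    also have "\<dots> = e j" using that eI by (intro D.add.finprod_singleton) auto
    finally show ?thesis .
  qed
  have "?h x = x" if x: "x \<in> carrier D" for x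
  proof -
    obtain a where a: "a \<in> e ` ?I \<rightarrow> carrier K" "D.lincomb a (e ` ?I) = x"
      using D.finite_in_span[of "e ` ?I" x] e span x by auto
    \<comment> \<open>The span lemma gives coefficients indexed by vectors; injectivity of
      \<open>e\<close> turns the sum over the image into a sum over indices.\<close>
    have x: "x = (\<Oplus>\<^bsub>D\<^esub>i\<in>?I. a (e i) \<odot>\<^bsub>D\<^esub> e i)"
      unfolding a(2)[symmetric] D.lincomb_def using a(1) inj eI
      by (intro D.finsum_reindex) (auto simp: Pi_iff)
    have ae: "(\<lambda>i. a (e i) \<odot>\<^bsub>D\<^esub> e i) \<in> ?I \<rightarrow> carrier D"
      using a(1) eI by (auto simp: Pi_iff)
    have "?h x = (\<Oplus>\<^bsub>D\<^esub>i\<in>?I. ?h (a (e i) \<odot>\<^bsub>D\<^esub> e i))"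
      unfolding x by (rule module_hom_finsum[OF D.module_axioms D.module_axioms h ae])
    also have "\<dots> = (\<Oplus>\<^bsub>D\<^esub>i\<in>?I. a (e i) \<odot>\<^bsub>D\<^esub> e i)"
    proof (rule D.finsum_cong'[OF refl ae])
      fix i assume i: "i \<in> ?I"
      then have "a (e i) \<in> carrier K" using a(1) by auto
      then show "?h (a (e i) \<odot>\<^bsub>D\<^esub> e i) = a (e i) \<odot>\<^bsub>D\<^esub> e i"
        using module_hom_smult[OF h, of "a (e i)" "e i"] he[OF i] eI[OF i] by simp
    qed
    finally show ?thesis using x by simp
  qed
  then show ?thesis
    using eI g by (simp add: dual_frame_def)
qed

text \<open>This one-element frame serves the counit law, in which the right factor is the ground
  space.\<close>

lemma ground_space_dual_frame:
  assumes "cring K"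
  shows "dual_frame K (ground_space K) {()} (\<lambda>_. \<one>\<^bsub>K\<^esub>) (\<lambda>_. id)"
proof -
  interpret G: module K "ground_space K" by (rule ground_space_module[OF assms])
  have "\<one>\<^bsub>K\<^esub> \<in> carrier (ground_space K)" "\<And>x. x \<in> carrier (ground_space K) \<Longrightarrow> x \<in> carrier K"
    "\<And>x. x \<in> carrier (ground_space K) \<Longrightarrow> x \<odot>\<^bsub>ground_space K\<^esub> \<one>\<^bsub>K\<^esub> = x"
    by (auto simp: ground_space_def)
  then show ?thesis
    by (simp add: dual_frame_def module_hom_id)
qed

text \<open>Both sides are linear in \<open>t\<close>. On \<open>a \<otimes> b\<close> the
  coefficients \<open>\<delta> i b\<close> move from the left entry to the right one, where the
  frame rebuilds \<open>b\<close>.\<close>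

lemma dual_frame_tensor_expand:
  assumes A: "module K A" and D: "module K D" and fr: "dual_frame K D I d \<delta>"
    and t: "t \<in> carrier (tensor_space K A D)"
  shows "(\<Oplus>\<^bsub>tensor_space K A D\<^esub>i\<in>I. pure_tensor K A D (tensor_contract K A D (\<delta> i) t) (d i)) = t"
proof -
  let ?T = "tensor_space K A D"
  let ?p = "pure_tensor K A D"
  interpret A: module K A by fact
  interpret D: module K D by fact
  interpret T: module K ?T by (rule tensor_space_module[OF A D])
  note \<delta> = dual_frameD[OF fr]
  note contract = tensor_contract_hom[OF D \<delta>(3) A]
  note bil = pure_tensor_bilinear[OF A D]
  have hom: "(\<lambda>t. ?p (tensor_contract K A D (\<delta> i) t) (d i)) \<in> module_hom K ?T ?T" if "i \<in> I" for i
    using module_hom_comp[OF bilinear_map_left_hom[OF bil \<delta>(2)[OF that]] contract[OF that]]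
    by (simp add: o_def)
  have "(\<lambda>t. \<Oplus>\<^bsub>?T\<^esub>i\<in>I. ?p (tensor_contract K A D (\<delta> i) t) (d i)) t = id t"
  proof (rule tensor_hom_eqI[OF A D _ module_hom_id _ t])
    show "(\<lambda>t. \<Oplus>\<^bsub>?T\<^esub>i\<in>I. ?p (tensor_contract K A D (\<delta> i) t) (d i)) \<in> module_hom K ?T ?T"
      by (intro module_hom_finsum_closed T.module_axioms hom)
    fix a b assume a: "a \<in> carrier A" and b: "b \<in> carrier D"
    have "(\<Oplus>\<^bsub>?T\<^esub>i\<in>I. ?p (tensor_contract K A D (\<delta> i) (?p a b)) (d i)) =
      (\<Oplus>\<^bsub>?T\<^esub>i\<in>I. ?p a (\<delta> i b \<odot>\<^bsub>D\<^esub> d i))"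
      using a b \<delta> by (intro T.finsum_cong')
        (auto simp: tensor_contract_pure[OF D \<delta>(3) A] pure_tensor_smult_left[OF A D]
          pure_tensor_smult_right[OF A D] pure_tensor_closed[OF A D])
    also have "\<dots> = ?p a (\<Oplus>\<^bsub>D\<^esub>i\<in>I. \<delta> i b \<odot>\<^bsub>D\<^esub> d i)"
      using a b \<delta> by (intro module_hom_finsum[OF D T.module_axioms bilinear_map_right_hom[OF bil], symmetric])
        auto
    finally show "(\<Oplus>\<^bsub>?T\<^esub>i\<in>I. ?p (tensor_contract K A D (\<delta> i) (?p a b)) (d i)) = id (?p a b)"
      using b \<delta>(4) by simp
  qed
  then show ?thesis by simp
qed

text \<open>The functional of index \<open>(i, j)\<close> contracts the factor \<open>C\<close> with
  \<open>\<gamma> j\<close> and then applies \<open>\<beta> i\<close>. Summing over \<open>i\<close>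
  rebuilds the contracted element of \<open>B\<close>; summing over \<open>j\<close> then rebuilds
  \<open>t\<close>.\<close>

lemma tensor_dual_frame:
  assumes B: "module K B" and C: "module K C"
    and frB: "dual_frame K B I b \<beta>" and frC: "dual_frame K C J c \<gamma>"
  shows "dual_frame K (tensor_space K B C) (I \<times> J) (\<lambda>(i, j). pure_tensor K B C (b i) (c j))
    (\<lambda>(i, j) t. \<beta> i (tensor_contract K B C (\<gamma> j) t))"
proof -
  let ?T = "tensor_space K B C"
  let ?p = "pure_tensor K B C"
  let ?k = "\<lambda>j. tensor_contract K B C (\<gamma> j)"
  interpret B: module K B by fact
  interpret C: module K C by fact
  interpret T: module K ?T by (rule tensor_space_module[OF B C])
  note b = dual_frameD[OF frB] and c = dual_frameD[OF frC]
  note bil = pure_tensor_bilinear[OF B C]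
  have k: "?k j \<in> module_hom K ?T B" if "j \<in> J" for j
    using tensor_contract_hom[OF C c(3) B] that .
  have hom: "(\<lambda>t. \<beta> i (?k j t)) \<in> module_hom K ?T (ground_space K)" if "i \<in> I" "j \<in> J" for i j
    using module_hom_comp[OF b(3)[OF that(1)] k[OF that(2)]] by (simp add: o_def)
  have expand: "finsum ?T (\<lambda>(i, j). \<beta> i (?k j t) \<odot>\<^bsub>?T\<^esub> ?p (b i) (c j)) (I \<times> J) = t"
    if t: "t \<in> carrier ?T" for t
  proof -
    have kt: "?k j t \<in> carrier B" if "j \<in> J" for j
      using module_hom_mem[OF k[OF that] t] .
    have \<beta>kt: "\<beta> i (?k j t) \<in> carrier K" if "i \<in> I" "j \<in> J" for i j
      using b(5) kt that by simp
    have "finsum ?T (\<lambda>(i, j). \<beta> i (?k j t) \<odot>\<^bsub>?T\<^esub> ?p (b i) (c j)) (I \<times> J) =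
      (\<Oplus>\<^bsub>?T\<^esub>i\<in>I. \<Oplus>\<^bsub>?T\<^esub>j\<in>J. \<beta> i (?k j t) \<odot>\<^bsub>?T\<^esub> ?p (b i) (c j))"
      using b(1,2) c(1,2) \<beta>kt
      by (intro T.add.finprod_finprod[symmetric]) (simp_all add: pure_tensor_closed[OF B C])
    \<comment> \<open>The sum over \<open>i\<close> is brought inside, since the frame of
      \<open>B\<close> collapses it for each fixed \<open>j\<close>.\<close>
    also have "\<dots> = (\<Oplus>\<^bsub>?T\<^esub>j\<in>J. \<Oplus>\<^bsub>?T\<^esub>i\<in>I. \<beta> i (?k j t) \<odot>\<^bsub>?T\<^esub> ?p (b i) (c j))"
      using b(1,2) c(1,2) \<beta>kt
      by (intro T.add.finprod_finprod_swap) (simp_all add: pure_tensor_closed[OF B C])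
    also have "\<dots> = (\<Oplus>\<^bsub>?T\<^esub>j\<in>J. ?p (?k j t) (c j))"
    proof (rule T.finsum_cong'[OF refl])
      show "(\<lambda>j. ?p (?k j t) (c j)) \<in> J \<rightarrow> carrier ?T"
        using kt c(2) by (auto intro: pure_tensor_closed[OF B C])
      fix j assume j: "j \<in> J"
      have "(\<Oplus>\<^bsub>?T\<^esub>i\<in>I. \<beta> i (?k j t) \<odot>\<^bsub>?T\<^esub> ?p (b i) (c j)) =
        (\<Oplus>\<^bsub>?T\<^esub>i\<in>I. ?p (\<beta> i (?k j t) \<odot>\<^bsub>B\<^esub> b i) (c j))"
        using j b(2) c(2) \<beta>kt by (intro T.finsum_cong')
          (auto simp: pure_tensor_smult_left[OF B C] pure_tensor_closed[OF B C])
      also have "\<dots> = ?p (\<Oplus>\<^bsub>B\<^esub>i\<in>I. \<beta> i (?k j t) \<odot>\<^bsub>B\<^esub> b i) (c j)"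
        using j b(2) c(2) \<beta>kt
        by (intro module_hom_finsum[OF B T.module_axioms bilinear_map_left_hom[OF bil], symmetric]) auto
      finally show "(\<Oplus>\<^bsub>?T\<^esub>i\<in>I. \<beta> i (?k j t) \<odot>\<^bsub>?T\<^esub> ?p (b i) (c j)) = ?p (?k j t) (c j)"
        using b(4)[OF kt[OF j]] by simp
    qed
    also have "\<dots> = t" by (rule dual_frame_tensor_expand[OF B C frC t])
    finally show ?thesis .
  qed
  then show ?thesis
    using b(1,2) c(1,2) hom pure_tensor_closed[OF B C]
    by (simp add: dual_frame_def case_prod_beta mem_Times_iff expand[unfolded case_prod_beta])
qed

text \<open>The contractions against a frame of \<open>D\<close> determine an element of \<open>M \<otimes> D\<close>, and they commute
  with the maps \<open>ev v\<close>.\<close>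

lemma tensor_eqI_jointly_injective:
  assumes mods: "module K M" "module K A" "module K D" and fr: "dual_frame K D I d \<delta>"
    and ev: "\<And>v. v \<in> S \<Longrightarrow> ev v \<in> module_hom K M A"
    and inj: "\<And>m m'. \<lbrakk>m \<in> carrier M; m' \<in> carrier M; \<And>v. v \<in> S \<Longrightarrow> ev v m = ev v m'\<rbrakk> \<Longrightarrow> m = m'"
    and xy: "x \<in> carrier (tensor_space K M D)" "y \<in> carrier (tensor_space K M D)"
    and eq: "\<And>v. v \<in> S \<Longrightarrow> tensor_map K M D A D (ev v) id x = tensor_map K M D A D (ev v) id y"
  shows "x = y"
proof -
  interpret T: module K "tensor_space K M D" by (intro tensor_space_module mods)
  note \<delta> = dual_frameD[OF fr]
  note contract = module_hom_mem[OF tensor_contract_hom[OF mods(3) \<delta>(3) mods(1)]]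
  have "tensor_contract K M D (\<delta> i) x = tensor_contract K M D (\<delta> i) y" if i: "i \<in> I" for i
    using tensor_contract_natural[OF mods(3) \<delta>(3)[OF i] mods(1,2) ev] xy eq
    by (intro inj contract i) simp_all
  then have "(\<Oplus>\<^bsub>tensor_space K M D\<^esub>i\<in>I. pure_tensor K M D (tensor_contract K M D (\<delta> i) x) (d i)) =
    (\<Oplus>\<^bsub>tensor_space K M D\<^esub>i\<in>I. pure_tensor K M D (tensor_contract K M D (\<delta> i) y) (d i))"
    using \<delta>(2) xy contract
    by (intro T.finsum_cong') (auto intro: pure_tensor_closed[OF mods(1,3)])
  then show ?thesis
    using dual_frame_tensor_expand[OF mods(1,3) fr] xy by simp
qed

section \<open>Spaces of linear maps\<close>

lemma hom_space_carrier:
  "F \<in> carrier (hom_space K A B) \<longleftrightarrow> F \<in> module_hom K A B \<and> F \<in> extensional (carrier A)"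
  by (simp add: hom_space_def)

lemma hom_space_ops:
  "\<zero>\<^bsub>hom_space K A B\<^esub> = (\<lambda>x\<in>carrier A. \<zero>\<^bsub>B\<^esub>)"
  "f \<oplus>\<^bsub>hom_space K A B\<^esub> g = (\<lambda>x\<in>carrier A. f x \<oplus>\<^bsub>B\<^esub> g x)"
  "k \<odot>\<^bsub>hom_space K A B\<^esub> f = (\<lambda>x\<in>carrier A. k \<odot>\<^bsub>B\<^esub> f x)"
  by (simp_all add: hom_space_def)

lemma restrict_module_hom:
  "\<lbrakk>module K A; f \<in> module_hom K A B\<rbrakk> \<Longrightarrow> (\<lambda>x\<in>carrier A. f x) \<in> carrier (hom_space K A B)"
  using module_hom_cong[of A f "\<lambda>x\<in>carrier A. f x" K B] by (simp add: hom_space_carrier)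

text \<open>The operations are pointwise, so each law holds because it holds in \<open>B\<close> at
  every point; extensionality turns agreement on \<open>carrier A\<close> into equality.\<close>

lemma hom_space_module:
  assumes A: "module K A" and B: "module K B"
  shows "module K (hom_space K A B)"
proof -
  interpret A: module K A by fact
  interpret B: module K B by fact
  let ?H = "hom_space K A B"
  have mem: "f x \<in> carrier B" if "f \<in> carrier ?H" "x \<in> carrier A" for f x
    using that by (auto simp: hom_space_carrier module_hom_mem)
  have ext: "f = g" if "f \<in> carrier ?H" "g \<in> carrier ?H" "\<And>x. x \<in> carrier A \<Longrightarrow> f x = g x" for f g
    using that by (auto simp: hom_space_carrier intro: extensionalityI)
  have zero: "\<zero>\<^bsub>?H\<^esub> \<in> carrier ?H"
    unfolding hom_space_ops by (intro restrict_module_hom A module_homI) auto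
  have add: "f \<oplus>\<^bsub>?H\<^esub> g \<in> carrier ?H" if "f \<in> carrier ?H" "g \<in> carrier ?H" for f g
    unfolding hom_space_ops using that
    by (intro restrict_module_hom module_hom_add_closed A B) (auto simp: hom_space_carrier)
  have smult: "k \<odot>\<^bsub>?H\<^esub> f \<in> carrier ?H" if "k \<in> carrier K" "f \<in> carrier ?H" for k f
    unfolding hom_space_ops using that
    by (intro restrict_module_hom module_hom_smult_closed A B) (auto simp: hom_space_carrier)
  have neg: "\<exists>g\<in>carrier ?H. f \<oplus>\<^bsub>?H\<^esub> g = \<zero>\<^bsub>?H\<^esub>" if f: "f \<in> carrier ?H" for f
  proof (rule bexI)
    \<comment> \<open>The negative is taken as the multiple by minus one, which makes its membership
      an instance of \<open>smult\<close>.\<close>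
    show g: "(\<ominus>\<^bsub>K\<^esub> \<one>\<^bsub>K\<^esub>) \<odot>\<^bsub>?H\<^esub> f \<in> carrier ?H" using f by (intro smult) auto
    show "f \<oplus>\<^bsub>?H\<^esub> (\<ominus>\<^bsub>K\<^esub> \<one>\<^bsub>K\<^esub>) \<odot>\<^bsub>?H\<^esub> f = \<zero>\<^bsub>?H\<^esub>"
      by (rule ext[OF add[OF f g] zero])
        (simp add: hom_space_ops mem f B.smult_l_minus B.r_neg)
  qed
  note ops = zero add smult
  show ?thesis
  proof (rule module_criteria[OF A.R.cring_axioms zero])
    show "\<forall>f\<in>carrier ?H. \<exists>g\<in>carrier ?H. f \<oplus>\<^bsub>?H\<^esub> g = \<zero>\<^bsub>?H\<^esub>" using neg by blast
  qed (safe; (intro ops ext | simp only: ops); (assumption | intro ops | simp add: hom_space_ops mem B.a_ac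
      B.smult_assoc1 B.smult_l_distr B.smult_r_distr)+)+
qed

lemma hom_space_eval_hom:
  "v \<in> carrier A \<Longrightarrow> (\<lambda>F. F v) \<in> module_hom K (hom_space K A B) B"
  by (rule module_homI) (auto simp: hom_space_carrier hom_space_ops module_hom_mem)

text \<open>On a pure tensor \<open>F\<close> enters through the right entry, in which the tensor
  product is linear. This makes the right-hand side of the equation defining \<open>W\<close> linear
  in the unknown \<open>F\<close>.\<close>

lemma tensor_map_hom_space:
  assumes mods: "module K A" "module K B" "module K C" "module K D"
    and f: "f \<in> module_hom K A C" and t: "t \<in> carrier (tensor_space K A B)"
  shows "(\<lambda>F. tensor_map K A B C D f F t) \<in> module_hom K (hom_space K B D) (tensor_space K C D)"
proof -
  let ?H = "hom_space K B D"
  interpret H: module K ?H by (intro hom_space_module mods)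
  interpret T: module K "tensor_space K C D" by (intro tensor_space_module mods)
  have hom: "F \<in> module_hom K B D" if "F \<in> carrier ?H" for F
    using that by (simp add: hom_space_carrier)
  note tm = tensor_map_hom[OF mods f hom] and pure = tensor_map_pure[OF mods f hom]
  have mod: "module K (tensor_space K A B)" by (intro tensor_space_module mods)
  show ?thesis
  proof (rule module_homI)
    fix F G assume *: "F \<in> carrier ?H" "G \<in> carrier ?H"
    show "tensor_map K A B C D f (F \<oplus>\<^bsub>?H\<^esub> G) t =
      tensor_map K A B C D f F t \<oplus>\<^bsub>tensor_space K C D\<^esub> tensor_map K A B C D f G t"
    proof (rule tensor_hom_eqI[OF mods(1,2) _ _ _ t])
      show "(\<lambda>t. tensor_map K A B C D f F t \<oplus>\<^bsub>tensor_space K C D\<^esub> tensor_map K A B C D f G t)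
        \<in> module_hom K (tensor_space K A B) (tensor_space K C D)"
        using * by (intro module_hom_add_closed mod tm T.module_axioms)
      fix a b assume ab: "a \<in> carrier A" "b \<in> carrier B"
      have "tensor_map K A B C D f (F \<oplus>\<^bsub>?H\<^esub> G) (pure_tensor K A B a b) =
        pure_tensor K C D (f a) (F b \<oplus>\<^bsub>D\<^esub> G b)"
        using ab * by (simp only: pure H.a_closed) (simp add: hom_space_ops)
      then show "tensor_map K A B C D f (F \<oplus>\<^bsub>?H\<^esub> G) (pure_tensor K A B a b) =
        tensor_map K A B C D f F (pure_tensor K A B a b) \<oplus>\<^bsub>tensor_space K C D\<^esub>
        tensor_map K A B C D f G (pure_tensor K A B a b)"
        using ab * by (simp add: pure pure_tensor_add_right[OF mods(3,4)] module_hom_mem[OF f]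
            module_hom_mem[OF hom])
    qed (use * in \<open>intro tm H.a_closed\<close>)
  next
    fix k F assume *: "k \<in> carrier K" "F \<in> carrier ?H"
    show "tensor_map K A B C D f (k \<odot>\<^bsub>?H\<^esub> F) t =
      k \<odot>\<^bsub>tensor_space K C D\<^esub> tensor_map K A B C D f F t"
    proof (rule tensor_hom_eqI[OF mods(1,2) _ _ _ t])
      show "(\<lambda>t. k \<odot>\<^bsub>tensor_space K C D\<^esub> tensor_map K A B C D f F t)
        \<in> module_hom K (tensor_space K A B) (tensor_space K C D)"
        using * by (intro module_hom_smult_closed mod tm T.module_axioms)
      fix a b assume ab: "a \<in> carrier A" "b \<in> carrier B"
      have "tensor_map K A B C D f (k \<odot>\<^bsub>?H\<^esub> F) (pure_tensor K A B a b) =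
        pure_tensor K C D (f a) (k \<odot>\<^bsub>D\<^esub> F b)"
        using ab * by (simp only: pure H.smult_closed) (simp add: hom_space_ops)
      then show "tensor_map K A B C D f (k \<odot>\<^bsub>?H\<^esub> F) (pure_tensor K A B a b) =
        k \<odot>\<^bsub>tensor_space K C D\<^esub> tensor_map K A B C D f F (pure_tensor K A B a b)"
        using ab * by (simp add: pure pure_tensor_smult_right[OF mods(3,4)] module_hom_mem[OF f]
            module_hom_mem[OF hom])
    qed (use * in \<open>intro tm H.smult_closed\<close>)
  qed (rule module_hom_mem[OF tm t])
qed

section \<open>Submodules cut out by linear equations\<close>

lemma equalizer_submodule:
  assumes mods: "module K M" "module K N"
    and f: "\<And>v. v \<in> S \<Longrightarrow> f v \<in> module_hom K M N" and g: "\<And>v. v \<in> S \<Longrightarrow> g v \<in> module_hom K M N"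
  shows "submodule K {x \<in> carrier M. \<forall>v\<in>S. f v x = g v x} M"
proof -
  interpret M: module K M by fact
  show ?thesis
    by unfold_locales
      (auto simp: module_hom_add[OF f] module_hom_add[OF g] module_hom_smult[OF f]
        module_hom_smult[OF g] module_hom_zero[OF mods f] module_hom_zero[OF mods g])
qed

section \<open>The comodule \<open>W\<close>\<close>

context
  fixes K :: "'k ring" and G :: "'p monoid" (structure)
    and H :: "'p \<Rightarrow> ('k, 'h) module"
    and \<Delta>H :: "'p \<Rightarrow> 'p \<Rightarrow> 'h \<Rightarrow> ('k, 'h, 'h) tensor"
    and \<epsilon>H :: "'h \<Rightarrow> 'k" and S :: "'p \<Rightarrow> 'h \<Rightarrow> 'h"
    and C :: "'p \<Rightarrow> ('k, 'c) module"
    and \<Delta>C :: "'p \<Rightarrow> 'p \<Rightarrow> 'c \<Rightarrow> ('k, 'c, 'c) tensor"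
    and \<epsilon>C :: "'c \<Rightarrow> 'k"
    and \<omega> :: "'p \<Rightarrow> ('k, 'h, 'c) tensor \<Rightarrow> 'c" and \<sigma> :: "'p \<Rightarrow> 'h \<Rightarrow> 'c"
    and V :: "'p \<Rightarrow> ('k, 'v) module"
    and \<rho> :: "'p \<Rightarrow> 'p \<Rightarrow> 'v \<Rightarrow> ('k, 'c, 'v) tensor"
  assumes coisotropic: "left_coisotropic_subgroup K G H \<Delta>H \<epsilon>H S C \<Delta>C \<epsilon>C \<omega> \<sigma>"
    and comodule: "left_pi_comodule K G C \<Delta>C \<epsilon>C V \<rho>"
begin

interpretation L: left_coisotropic_subgroup K G H \<Delta>H \<epsilon>H S C \<Delta>C \<epsilon>C \<omega> \<sigma>
  by (rule coisotropic)

interpretation V: left_pi_comodule K G C \<Delta>C \<epsilon>C V \<rho>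
  by (rule comodule)

private abbreviation (input) "W \<equiv> W_space K G H \<Delta>H C \<sigma> V \<rho>"
private abbreviation (input) "LT \<equiv> left_translation K G H \<Delta>H C \<sigma>"
private abbreviation (input) "contr \<equiv> W_contract K G H \<Delta>H V"

private lemma K_cring: "cring K" and K_field: "field K"
  by unfold_locales

private lemma H_module: "\<alpha> \<in> carrier G \<Longrightarrow> module K (H \<alpha>)"
  using L.hopf.component_space by (simp add: vectorspace_def)

private lemma C_module: "\<alpha> \<in> carrier G \<Longrightarrow> module K (C \<alpha>)"
  using L.coalg.component_space by (simp add: vectorspace_def)

private lemma V_module: "\<alpha> \<in> carrier G \<Longrightarrow> module K (V \<alpha>)"
  using V.comodule_space by (simp add: vectorspace_def)

private lemmas ground_module = ground_space_module[OF K_cring]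

private lemmas modules = H_module C_module V_module ground_module tensor_space_module

private lemma comult_hom:
  "\<lbrakk>\<alpha> \<in> carrier G; \<beta> \<in> carrier G\<rbrakk> \<Longrightarrow>
    \<Delta>H \<alpha> \<beta> \<in> module_hom K (H (\<alpha> \<otimes> \<beta>)) (tensor_space K (H \<alpha>) (H \<beta>))"
  using L.hopf.comult_linear by (simp add: linear_map_iff)

private lemma comult_one_hom:
  "\<alpha> \<in> carrier G \<Longrightarrow> \<Delta>H \<one> \<alpha> \<in> module_hom K (H \<alpha>) (tensor_space K (H \<one>) (H \<alpha>))"
  using comult_hom[of \<one> \<alpha>] by simp

private lemma sigma_hom: "\<alpha> \<in> carrier G \<Longrightarrow> \<sigma> \<alpha> \<in> module_hom K (H \<alpha>) (C \<alpha>)"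
  using L.sigma_linear by (simp add: linear_map_iff)

private lemma rho_one_hom: "\<rho> \<one> \<one> \<in> module_hom K (V \<one>) (tensor_space K (C \<one>) (V \<one>))"
  using V.coaction_linear[of \<one> \<one>] by (simp add: linear_map_iff)

private lemma left_translation_hom:
  assumes "\<alpha> \<in> carrier G"
  shows "LT \<alpha> \<in> module_hom K (H \<alpha>) (tensor_space K (C \<one>) (H \<alpha>))"
  using module_hom_comp[OF tensor_map_hom[OF H_module H_module C_module H_module sigma_hom module_hom_id]
      comult_one_hom] assms
  by (simp add: left_translation_def[abs_def] o_def)

text \<open>Puts the defining condition into the shape of \<open>equalizer_submodule\<close>: for
  each \<open>v\<close>, an equation between two linear expressions in \<open>F\<close>.\<close>

lemma W_space_equalizer:
  "W \<alpha> = (hom_space K (V \<one>) (H \<alpha>))\<lparr>carrier := {F \<in> carrier (hom_space K (V \<one>) (H \<alpha>)).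
     \<forall>v\<in>carrier (V \<one>). (LT \<alpha> \<circ> (\<lambda>F. F v)) F =
       tensor_map K (C \<one>) (V \<one>) (C \<one>) (H \<alpha>) id F (\<rho> \<one> \<one> v)}\<rparr>"
  by (simp add: W_space_def)

lemma W_space_module:
  assumes \<alpha>: "\<alpha> \<in> carrier G"
  shows "module K (W \<alpha>)"
proof -
  interpret hs: module K "hom_space K (V \<one>) (H \<alpha>)"
    using \<alpha> by (intro hom_space_module modules) auto
  show ?thesis
    unfolding W_space_equalizer
  proof (rule hs.submodule_is_module, rule equalizer_submodule[OF hs.module_axioms])
    show "module K (tensor_space K (C \<one>) (H \<alpha>))" using \<alpha> by (intro modules) auto
    fix v assume v: "v \<in> carrier (V \<one>)"
    show "LT \<alpha> \<circ> (\<lambda>F. F v) \<in> module_hom K (hom_space K (V \<one>) (H \<alpha>)) (tensor_space K (C \<one>) (H \<alpha>))"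
      using \<alpha> v by (intro module_hom_comp[OF left_translation_hom hom_space_eval_hom])
    show "(\<lambda>F. tensor_map K (C \<one>) (V \<one>) (C \<one>) (H \<alpha>) id F (\<rho> \<one> \<one> v))
      \<in> module_hom K (hom_space K (V \<one>) (H \<alpha>)) (tensor_space K (C \<one>) (H \<alpha>))"
      using \<alpha> v by (intro tensor_map_hom_space modules module_hom_id module_hom_mem[OF rho_one_hom]) auto
  qed
qed

private lemma W_hom: "F \<in> carrier (W \<alpha>) \<Longrightarrow> F \<in> module_hom K (V \<one>) (H \<alpha>)"
  by (simp add: W_space_def hom_space_carrier)

text \<open>Elements of \<open>W \<alpha>\<close> are extensional, so their values on
  \<open>V \<one>\<close> determine them. This is the joint injectivity of the evaluation
  maps.\<close>

private lemma W_ext: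
  "\<lbrakk>F \<in> carrier (W \<alpha>); F' \<in> carrier (W \<alpha>); \<And>v. v \<in> carrier (V \<one>) \<Longrightarrow> F v = F' v\<rbrakk> \<Longrightarrow> F = F'"
  by (auto simp: W_space_def hom_space_carrier intro: extensionalityI)

private lemma W_eval_hom: "v \<in> carrier (V \<one>) \<Longrightarrow> (\<lambda>F. F v) \<in> module_hom K (W \<alpha>) (H \<alpha>)"
  using hom_space_eval_hom[of v "V \<one>" K "H \<alpha>"]
  by (simp add: module_hom_def W_space_def Pi_iff hom_space_ops)

section \<open>Contracted comultiplications preserve \<open>W\<close>\<close>

private lemma W_contract_eq:
  "contr \<alpha> \<beta> \<chi> F = (\<lambda>v\<in>carrier (V \<one>). tensor_contract K (H \<alpha>) (H \<beta>) \<chi> (\<Delta>H \<alpha> \<beta> (F v)))"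
  by (simp add: W_contract_def tensor_contract_def)

private lemma contract_comult_hom:
  assumes "\<alpha> \<in> carrier G" "\<beta> \<in> carrier G" "\<chi> \<in> module_hom K (H \<beta>) (ground_space K)"
  shows "tensor_contract K (H \<alpha>) (H \<beta>) \<chi> \<circ> \<Delta>H \<alpha> \<beta> \<in> module_hom K (H (\<alpha> \<otimes> \<beta>)) (H \<alpha>)"
  using assms by (intro module_hom_comp[OF tensor_contract_hom comult_hom] H_module)

text \<open>Left translation splits off a factor on the left and \<kappa> removes one on the right;
  coassociativity lets the two operations change places.\<close>

lemma left_translation_contract:
  assumes \<alpha>: "\<alpha> \<in> carrier G" and \<beta>: "\<beta> \<in> carrier G"
    and \<chi>: "\<chi> \<in> module_hom K (H \<beta>) (ground_space K)"
    and x: "x \<in> carrier (H (\<alpha> \<otimes> \<beta>))"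
  defines "\<kappa> \<equiv> tensor_contract K (H \<alpha>) (H \<beta>) \<chi> \<circ> \<Delta>H \<alpha> \<beta>"
  shows "LT \<alpha> (\<kappa> x) = tensor_map K (C \<one>) (H (\<alpha> \<otimes> \<beta>)) (C \<one>) (H \<alpha>) id \<kappa> (LT (\<alpha> \<otimes> \<beta>) x)"
proof -
  let ?A = "H \<alpha>" and ?B = "H \<beta>" and ?AB = "H (\<alpha> \<otimes> \<beta>)" and ?H = "H \<one>" and ?C = "C \<one>"
  let ?k = "tensor_contract K ?A ?B \<chi>"
  note mods = H_module[OF \<alpha>] H_module[OF \<beta>] H_module[OF L.hopf.m_closed[OF \<alpha> \<beta>]]
    H_module[OF L.hopf.one_closed] C_module[OF L.hopf.one_closed] tensor_space_module
  have \<Delta>: "\<Delta>H \<alpha> \<beta> \<in> module_hom K ?AB (tensor_space K ?A ?B)"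
    "\<Delta>H \<one> \<alpha> \<in> module_hom K ?A (tensor_space K ?H ?A)"
    "\<Delta>H \<one> (\<alpha> \<otimes> \<beta>) \<in> module_hom K ?AB (tensor_space K ?H ?AB)"
    using \<alpha> \<beta> comult_hom comult_one_hom by auto
  have k: "?k \<in> module_hom K (tensor_space K ?A ?B) ?A"
    by (intro tensor_contract_hom mods \<chi>)
  have \<kappa>: "\<kappa> \<in> module_hom K ?AB ?A"
    unfolding \<kappa>_def by (rule contract_comult_hom[OF \<alpha> \<beta> \<chi>])
  have s: "\<sigma> \<one> \<in> module_hom K ?H ?C" by (rule sigma_hom) simp
  have \<Delta>x: "\<Delta>H \<alpha> \<beta> x \<in> carrier (tensor_space K ?A ?B)"
    "\<Delta>H \<one> (\<alpha> \<otimes> \<beta>) x \<in> carrier (tensor_space K ?H ?AB)"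
    by (intro module_hom_mem[OF \<Delta>(1) x] module_hom_mem[OF \<Delta>(3) x])+
  have \<Delta>\<Delta>x: "tensor_map K ?A ?B (tensor_space K ?H ?A) ?B (\<Delta>H \<one> \<alpha>) id (\<Delta>H \<alpha> \<beta> x)
    \<in> carrier (tensor_space K (tensor_space K ?H ?A) ?B)"
    by (intro module_hom_mem[OF tensor_map_hom] mods module_hom_id \<Delta> \<Delta>x)
  \<comment> \<open>Naturality of contraction, with \<open>\<Delta>H \<one> \<alpha>\<close> as the
    map on the left factor.\<close>
  have "\<Delta>H \<one> \<alpha> (\<kappa> x) = tensor_contract K (tensor_space K ?H ?A) ?B \<chi>
    (tensor_map K ?A ?B (tensor_space K ?H ?A) ?B (\<Delta>H \<one> \<alpha>) id (\<Delta>H \<alpha> \<beta> x))"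
    unfolding \<kappa>_def comp_apply by (intro tensor_contract_natural mods \<chi> \<Delta> \<Delta>x)
  \<comment> \<open>After reassociation the contraction acts inside
    \<open>H \<alpha> \<otimes> H \<beta>\<close>.\<close>
  also have "\<dots> = tensor_map K ?H (tensor_space K ?A ?B) ?H ?A id ?k (tensor_assoc K ?H ?A ?B
    (tensor_map K ?A ?B (tensor_space K ?H ?A) ?B (\<Delta>H \<one> \<alpha>) id (\<Delta>H \<alpha> \<beta> x)))"
    by (intro tensor_contract_assoc mods \<chi> \<Delta>\<Delta>x)
  \<comment> \<open>Coassociativity with the group unit as first index; the unit law identifies
    \<open>\<one> \<otimes> \<alpha>\<close> with \<alpha>.\<close>
  also have "\<dots> = tensor_map K ?H (tensor_space K ?A ?B) ?H ?A id ?k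
    (tensor_map K ?H ?AB ?H (tensor_space K ?A ?B) id (\<Delta>H \<alpha> \<beta>) (\<Delta>H \<one> (\<alpha> \<otimes> \<beta>) x))"
    using L.hopf.coassoc[OF L.hopf.one_closed \<alpha> \<beta>, of x] \<alpha> \<beta> x by simp
  also have "\<dots> = tensor_map K ?H ?AB ?H ?A (id \<circ> id) \<kappa> (\<Delta>H \<one> (\<alpha> \<otimes> \<beta>) x)"
    unfolding \<kappa>_def by (intro tensor_map_comp mods module_hom_id \<Delta> k \<Delta>x)
  finally have eq: "\<Delta>H \<one> \<alpha> (\<kappa> x) = tensor_map K ?H ?AB ?H ?A id \<kappa> (\<Delta>H \<one> (\<alpha> \<otimes> \<beta>) x)"
    by (simp only: id_o)
  \<comment> \<open>Now \<open>\<sigma> \<one>\<close> acts on the left factor and \<kappa> on the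
    right one. Padding with identities makes both orders instances of functoriality, so they
    agree.\<close>
  have "LT \<alpha> (\<kappa> x) = tensor_map K ?H ?AB ?C ?A (\<sigma> \<one> \<circ> id) (id \<circ> \<kappa>) (\<Delta>H \<one> (\<alpha> \<otimes> \<beta>) x)"
    unfolding left_translation_def eq by (intro tensor_map_comp mods module_hom_id \<kappa> s \<Delta>x)
  also have "\<dots> = tensor_map K ?H ?AB ?C ?A (id \<circ> \<sigma> \<one>) (\<kappa> \<circ> id) (\<Delta>H \<one> (\<alpha> \<otimes> \<beta>) x)"
    by (simp only: id_o o_id)
  also have "\<dots> = tensor_map K ?C ?AB ?C ?A id \<kappa> (LT (\<alpha> \<otimes> \<beta>) x)"
    unfolding left_translation_def
    by (intro tensor_map_comp[symmetric] mods module_hom_id \<kappa> s \<Delta>x)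
  finally show ?thesis .
qed

text \<open>On \<open>V \<one>\<close> the contracted map is \<open>\<kappa> \<circ> F\<close>. Left
  translation of its value is \<open>id \<otimes> \<kappa>\<close> applied to that of
  \<open>F v\<close>; the equation for \<open>F\<close> and functoriality then give the equation for
  \<open>\<kappa> \<circ> F\<close>.\<close>

lemma W_contract_closed:
  assumes \<alpha>: "\<alpha> \<in> carrier G" and \<beta>: "\<beta> \<in> carrier G"
    and \<chi>: "\<chi> \<in> module_hom K (H \<beta>) (ground_space K)"
    and F: "F \<in> carrier (W (\<alpha> \<otimes> \<beta>))"
  shows "contr \<alpha> \<beta> \<chi> F \<in> carrier (W \<alpha>)"
proof -
  let ?AB = "H (\<alpha> \<otimes> \<beta>)"
  define \<kappa> where "\<kappa> = tensor_contract K (H \<alpha>) (H \<beta>) \<chi> \<circ> \<Delta>H \<alpha> \<beta>"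
  note mods = H_module[OF \<alpha>] H_module[OF L.hopf.m_closed[OF \<alpha> \<beta>]]
    V_module[OF L.hopf.one_closed] C_module[OF L.hopf.one_closed]
  have \<kappa>: "\<kappa> \<in> module_hom K ?AB (H \<alpha>)"
    unfolding \<kappa>_def by (rule contract_comult_hom[OF \<alpha> \<beta> \<chi>])
  note Fh = W_hom[OF F]
  have eq: "contr \<alpha> \<beta> \<chi> F = (\<lambda>v\<in>carrier (V \<one>). (\<kappa> \<circ> F) v)"
    by (simp add: W_contract_eq \<kappa>_def)
  have hom: "contr \<alpha> \<beta> \<chi> F \<in> carrier (hom_space K (V \<one>) (H \<alpha>))"
    unfolding eq by (intro restrict_module_hom mods module_hom_comp[OF \<kappa> Fh])
  have "LT \<alpha> (contr \<alpha> \<beta> \<chi> F v) =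
    tensor_map K (C \<one>) (V \<one>) (C \<one>) (H \<alpha>) id (contr \<alpha> \<beta> \<chi> F) (\<rho> \<one> \<one> v)"
    if v: "v \<in> carrier (V \<one>)" for v
  proof -
    have \<rho>v: "\<rho> \<one> \<one> v \<in> carrier (tensor_space K (C \<one>) (V \<one>))"
      by (rule module_hom_mem[OF rho_one_hom v])
    have "LT \<alpha> (contr \<alpha> \<beta> \<chi> F v) = LT \<alpha> (\<kappa> (F v))"
      using v by (simp add: eq)
    also have "\<dots> = tensor_map K (C \<one>) ?AB (C \<one>) (H \<alpha>) id \<kappa> (LT (\<alpha> \<otimes> \<beta>) (F v))"
      unfolding \<kappa>_def by (rule left_translation_contract[OF \<alpha> \<beta> \<chi> module_hom_mem[OF Fh v]])
    also have "LT (\<alpha> \<otimes> \<beta>) (F v) = tensor_map K (C \<one>) (V \<one>) (C \<one>) ?AB id F (\<rho> \<one> \<one> v)"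
      using F v by (simp add: W_space_def)
    also have "tensor_map K (C \<one>) ?AB (C \<one>) (H \<alpha>) id \<kappa> \<dots> =
      tensor_map K (C \<one>) (V \<one>) (C \<one>) (H \<alpha>) (id \<circ> id) (\<kappa> \<circ> F) (\<rho> \<one> \<one> v)"
      by (intro tensor_map_comp mods module_hom_id \<kappa> Fh \<rho>v)
    \<comment> \<open>The contracted map is \<open>\<kappa> \<circ> F\<close> made undefined off the
      carrier of \<open>V \<one>\<close>, hence a congruence on carriers.\<close>
    also have "\<dots> = tensor_map K (C \<one>) (V \<one>) (C \<one>) (H \<alpha>) id (contr \<alpha> \<beta> \<chi> F) (\<rho> \<one> \<one> v)"
      by (rule tensor_map_cong[OF mods(4,3,4,1) _ module_hom_comp[OF \<kappa> Fh] _ _ \<rho>v])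
        (simp_all add: eq module_hom_id)
    finally show ?thesis .
  qed
  then show ?thesis using hom by (simp add: W_space_def)
qed

section \<open>The coaction on \<open>W\<close> and the comodule laws\<close>

context
  fixes n :: "'p \<Rightarrow> nat" and e :: "'p \<Rightarrow> nat \<Rightarrow> 'h" and g :: "'p \<Rightarrow> nat \<Rightarrow> 'h \<Rightarrow> 'k"
  assumes frame: "\<And>\<beta>. \<beta> \<in> carrier G \<Longrightarrow> dual_frame K (H \<beta>) {1..n \<beta>} (e \<beta>) (g \<beta>)"
begin

private abbreviation (input) "\<Omega> \<equiv> W_coaction K G H \<Delta>H C \<sigma> V \<rho> n e g"
private abbreviation (input) "ev \<alpha> D v \<equiv> tensor_map K (W \<alpha>) D (H \<alpha>) D (\<lambda>F. F v) id"

private lemma W_coaction_closed: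
  assumes "\<alpha> \<in> carrier G" "\<beta> \<in> carrier G" "F \<in> carrier (W (\<alpha> \<otimes> \<beta>))"
  shows "\<Omega> \<alpha> \<beta> F \<in> carrier (tensor_space K (W \<alpha>) (H \<beta>))"
proof -
  interpret T: module K "tensor_space K (W \<alpha>) (H \<beta>)"
    using assms by (intro modules W_space_module)
  show ?thesis
    unfolding W_coaction_def Let_def
    using assms dual_frameD[OF frame] W_contract_closed
    by (intro T.finsum_closed) (auto intro!: pure_tensor_closed H_module W_space_module)
qed

text \<open>Evaluating the left entries at \<open>v\<close> turns the sum defining \<Omega> into the
  frame expansion of \<open>\<Delta>H \<alpha> \<beta> (F v)\<close>, from which the chosen basis
  disappears. The comodule laws are deduced from this formula.\<close>

lemma eval_W_coaction:
  assumes \<alpha>: "\<alpha> \<in> carrier G" and \<beta>: "\<beta> \<in> carrier G" and F: "F \<in> carrier (W (\<alpha> \<otimes> \<beta>))"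
    and v: "v \<in> carrier (V \<one>)"
  shows "ev \<alpha> (H \<beta>) v (\<Omega> \<alpha> \<beta> F) = \<Delta>H \<alpha> \<beta> (F v)"
proof -
  let ?I = "{1..n \<beta>}"
  let ?TW = "tensor_space K (W \<alpha>) (H \<beta>)" and ?TH = "tensor_space K (H \<alpha>) (H \<beta>)"
  note mods = W_space_module[OF \<alpha>] H_module[OF \<alpha>] H_module[OF \<beta>]
  interpret TW: module K ?TW by (intro tensor_space_module mods)
  interpret TH: module K ?TH by (intro tensor_space_module mods)
  note fr = dual_frameD[OF frame[OF \<beta>]]
  have c: "contr \<alpha> \<beta> (g \<beta> i) F \<in> carrier (W \<alpha>)" if "i \<in> ?I" for i
    using W_contract_closed[OF \<alpha> \<beta> fr(3)[OF that] F] .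
  have \<Delta>v: "\<Delta>H \<alpha> \<beta> (F v) \<in> carrier ?TH"
    by (rule module_hom_mem[OF comult_hom[OF \<alpha> \<beta>] module_hom_mem[OF W_hom[OF F] v]])
  have "ev \<alpha> (H \<beta>) v (\<Omega> \<alpha> \<beta> F) =
    (\<Oplus>\<^bsub>?TH\<^esub>i\<in>?I. ev \<alpha> (H \<beta>) v (pure_tensor K (W \<alpha>) (H \<beta>) (contr \<alpha> \<beta> (g \<beta> i) F) (e \<beta> i)))"
    unfolding W_coaction_def Let_def using c fr(2)
    by (intro module_hom_finsum[OF TW.module_axioms TH.module_axioms] tensor_map_hom
        mods W_eval_hom[OF v] module_hom_id) (auto intro!: pure_tensor_closed mods)
  also have "\<dots> = (\<Oplus>\<^bsub>?TH\<^esub>i\<in>?I. pure_tensor K (H \<alpha>) (H \<beta>)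
    (tensor_contract K (H \<alpha>) (H \<beta>) (g \<beta> i) (\<Delta>H \<alpha> \<beta> (F v))) (e \<beta> i))"
  proof (rule TH.finsum_cong'[OF refl])
    show "(\<lambda>i. pure_tensor K (H \<alpha>) (H \<beta>)
      (tensor_contract K (H \<alpha>) (H \<beta>) (g \<beta> i) (\<Delta>H \<alpha> \<beta> (F v))) (e \<beta> i)) \<in> ?I \<rightarrow> carrier ?TH"
      using fr(2,3) \<Delta>v
      by (auto intro!: pure_tensor_closed mods module_hom_mem[OF tensor_contract_hom])
    fix i assume i: "i \<in> ?I"
    have "ev \<alpha> (H \<beta>) v (pure_tensor K (W \<alpha>) (H \<beta>) (contr \<alpha> \<beta> (g \<beta> i) F) (e \<beta> i)) =
      pure_tensor K (H \<alpha>) (H \<beta>) (contr \<alpha> \<beta> (g \<beta> i) F v) (id (e \<beta> i))"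
      by (rule tensor_map_pure[OF mods(1,3,2,3) W_eval_hom[OF v] module_hom_id c[OF i] fr(2)[OF i]])
    then show "ev \<alpha> (H \<beta>) v (pure_tensor K (W \<alpha>) (H \<beta>) (contr \<alpha> \<beta> (g \<beta> i) F) (e \<beta> i)) =
      pure_tensor K (H \<alpha>) (H \<beta>) (tensor_contract K (H \<alpha>) (H \<beta>) (g \<beta> i) (\<Delta>H \<alpha> \<beta> (F v))) (e \<beta> i)"
      using v by (simp add: W_contract_eq)
  qed
  also have "\<dots> = \<Delta>H \<alpha> \<beta> (F v)"
    by (rule dual_frame_tensor_expand[OF mods(2,3) frame[OF \<beta>] \<Delta>v])
  finally show ?thesis .
qed

text \<open>Evaluations separate the elements of \<open>W \<alpha>\<close>, and a frame of
  \<open>D\<close> carries this over to the tensor product.\<close>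

private lemma W_tensor_eqI:
  assumes "\<alpha> \<in> carrier G" "module K D" "dual_frame K D I d \<delta>"
    and "x \<in> carrier (tensor_space K (W \<alpha>) D)" "y \<in> carrier (tensor_space K (W \<alpha>) D)"
    and "\<And>v. v \<in> carrier (V \<one>) \<Longrightarrow> ev \<alpha> D v x = ev \<alpha> D v y"
  shows "x = y"
proof (rule tensor_eqI_jointly_injective[OF W_space_module[OF assms(1)] H_module[OF assms(1)]
      assms(2,3) _ _ assms(4,5,6)])
  show "F = F'" if "F \<in> carrier (W \<alpha>)" "F' \<in> carrier (W \<alpha>)"
    "\<And>v. v \<in> carrier (V \<one>) \<Longrightarrow> F v = F' v" for F F'
    by (rule W_ext[OF that])
qed (rule W_eval_hom)

text \<open>After evaluation at \<open>v\<close> the coaction becomes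
  \<open>\<Delta>H \<alpha> \<beta> (F v)\<close>, which is linear in \<open>F\<close>.\<close>

lemma W_coaction_hom:
  assumes \<alpha>: "\<alpha> \<in> carrier G" and \<beta>: "\<beta> \<in> carrier G"
  shows "\<Omega> \<alpha> \<beta> \<in> module_hom K (W (\<alpha> \<otimes> \<beta>)) (tensor_space K (W \<alpha>) (H \<beta>))"
proof -
  let ?M = "W (\<alpha> \<otimes> \<beta>)" and ?T = "tensor_space K (W \<alpha>) (H \<beta>)"
  note mods = W_space_module[OF \<alpha>] H_module[OF \<alpha>] H_module[OF \<beta>]
  interpret M: module K ?M using \<alpha> \<beta> by (intro W_space_module) auto
  interpret T: module K ?T by (intro tensor_space_module mods)
  note closed = W_coaction_closed[OF \<alpha> \<beta>] and eval = eval_W_coaction[OF \<alpha> \<beta>]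
  note eqI = W_tensor_eqI[OF \<alpha> mods(3) frame[OF \<beta>]]
  show ?thesis
  proof (rule module_homI)
    fix F F' assume *: "F \<in> carrier ?M" "F' \<in> carrier ?M"
    show "\<Omega> \<alpha> \<beta> (F \<oplus>\<^bsub>?M\<^esub> F') = \<Omega> \<alpha> \<beta> F \<oplus>\<^bsub>?T\<^esub> \<Omega> \<alpha> \<beta> F'"
    proof (rule eqI)
      fix v assume v: "v \<in> carrier (V \<one>)"
      have evh: "ev \<alpha> (H \<beta>) v \<in> module_hom K ?T (tensor_space K (H \<alpha>) (H \<beta>))"
        by (intro tensor_map_hom mods W_eval_hom v module_hom_id)
      show "ev \<alpha> (H \<beta>) v (\<Omega> \<alpha> \<beta> (F \<oplus>\<^bsub>?M\<^esub> F')) = ev \<alpha> (H \<beta>) v (\<Omega> \<alpha> \<beta> F \<oplus>\<^bsub>?T\<^esub> \<Omega> \<alpha> \<beta> F')"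
        using * v module_hom_mem[OF W_hom]
        by (simp add: eval module_hom_add[OF evh] closed module_hom_add[OF W_eval_hom]
            module_hom_add[OF comult_hom[OF \<alpha> \<beta>]])
    qed (use * closed in auto)
  next
    fix k F assume *: "k \<in> carrier K" "F \<in> carrier ?M"
    show "\<Omega> \<alpha> \<beta> (k \<odot>\<^bsub>?M\<^esub> F) = k \<odot>\<^bsub>?T\<^esub> \<Omega> \<alpha> \<beta> F"
    proof (rule eqI)
      fix v assume v: "v \<in> carrier (V \<one>)"
      have evh: "ev \<alpha> (H \<beta>) v \<in> module_hom K ?T (tensor_space K (H \<alpha>) (H \<beta>))"
        by (intro tensor_map_hom mods W_eval_hom v module_hom_id)
      show "ev \<alpha> (H \<beta>) v (\<Omega> \<alpha> \<beta> (k \<odot>\<^bsub>?M\<^esub> F)) = ev \<alpha> (H \<beta>) v (k \<odot>\<^bsub>?T\<^esub> \<Omega> \<alpha> \<beta> F)"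
        using * v module_hom_mem[OF W_hom]
        by (simp add: eval module_hom_smult[OF evh] closed module_hom_smult[OF W_eval_hom]
            module_hom_smult[OF comult_hom[OF \<alpha> \<beta>]])
    qed (use * closed in auto)
  qed (rule closed)
qed

text \<open>Evaluation at \<open>v\<close> commutes with reassociation and with maps on the right
  factor. It carries the claim to coassociativity of the comultiplication at
  \<open>F v\<close>.\<close>

lemma W_coaction_coassoc:
  assumes \<alpha>: "\<alpha> \<in> carrier G" and \<beta>: "\<beta> \<in> carrier G" and \<gamma>: "\<gamma> \<in> carrier G"
    and F: "F \<in> carrier (W (\<alpha> \<otimes> \<beta> \<otimes> \<gamma>))"
  shows "tensor_assoc K (W \<alpha>) (H \<beta>) (H \<gamma>)
      (tensor_map K (W (\<alpha> \<otimes> \<beta>)) (H \<gamma>) (tensor_space K (W \<alpha>) (H \<beta>)) (H \<gamma>)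
        (\<Omega> \<alpha> \<beta>) id (\<Omega> (\<alpha> \<otimes> \<beta>) \<gamma> F)) =
    tensor_map K (W \<alpha>) (H (\<beta> \<otimes> \<gamma>)) (W \<alpha>) (tensor_space K (H \<beta>) (H \<gamma>))
      id (\<Delta>H \<beta> \<gamma>) (\<Omega> \<alpha> (\<beta> \<otimes> \<gamma>) F)"
    (is "?lhs = ?rhs")
proof -
  let ?A = "H \<alpha>" and ?B = "H \<beta>" and ?C = "H \<gamma>" and ?AB = "H (\<alpha> \<otimes> \<beta>)" and ?BC = "H (\<beta> \<otimes> \<gamma>)"
  let ?D = "tensor_space K ?B ?C"
  have \<alpha>\<beta>: "\<alpha> \<otimes> \<beta> \<in> carrier G" and \<beta>\<gamma>: "\<beta> \<otimes> \<gamma> \<in> carrier G" using \<alpha> \<beta> \<gamma> by auto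
  \<comment> \<open>The same element, with the group product bracketed to fit
    \<open>\<Omega> \<alpha> (\<beta> \<otimes> \<gamma>)\<close>.\<close>
  have F': "F \<in> carrier (W (\<alpha> \<otimes> (\<beta> \<otimes> \<gamma>)))" using F \<alpha> \<beta> \<gamma> by (simp add: L.hopf.m_assoc)
  note mods = tensor_space_module W_space_module[OF \<alpha>] W_space_module[OF \<alpha>\<beta>] H_module[OF \<alpha>]
    H_module[OF \<beta>] H_module[OF \<gamma>] H_module[OF \<alpha>\<beta>] H_module[OF \<beta>\<gamma>]
  note homs = module_hom_id comult_hom[OF \<alpha> \<beta>] comult_hom[OF \<beta> \<gamma>] W_coaction_hom[OF \<alpha> \<beta>]
  note \<Omega>F = W_coaction_closed[OF \<alpha>\<beta> \<gamma> F] and \<Omega>F' = W_coaction_closed[OF \<alpha> \<beta>\<gamma> F']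
  let ?t = "tensor_map K (W (\<alpha> \<otimes> \<beta>)) ?C (tensor_space K (W \<alpha>) ?B) ?C (\<Omega> \<alpha> \<beta>) id
    (\<Omega> (\<alpha> \<otimes> \<beta>) \<gamma> F)"
  have t: "?t \<in> carrier (tensor_space K (tensor_space K (W \<alpha>) ?B) ?C)"
    by (intro module_hom_mem[OF tensor_map_hom] mods homs \<Omega>F)
  have lhs: "?lhs \<in> carrier (tensor_space K (W \<alpha>) ?D)"
    by (intro module_hom_mem[OF tensor_assoc_hom] mods t)
  have rhs: "?rhs \<in> carrier (tensor_space K (W \<alpha>) ?D)"
    by (intro module_hom_mem[OF tensor_map_hom] mods homs \<Omega>F')
  show ?thesis
  \<comment> \<open>The right factor is now \<open>H \<beta> \<otimes> H \<gamma>\<close>, with the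
    frame built from those of its two factors.\<close>
  proof (rule W_tensor_eqI[OF \<alpha> _ tensor_dual_frame[OF mods(5,6) frame[OF \<beta>] frame[OF \<gamma>]] lhs rhs])
    show "module K ?D" by (intro mods)
    fix v assume v: "v \<in> carrier (V \<one>)"
    note ev = W_eval_hom[OF v]
    have evB: "ev \<alpha> ?B v \<in> module_hom K (tensor_space K (W \<alpha>) ?B) (tensor_space K ?A ?B)"
      by (intro tensor_map_hom mods homs ev)
    have Fv: "F v \<in> carrier (H (\<alpha> \<otimes> \<beta> \<otimes> \<gamma>))" by (rule module_hom_mem[OF W_hom[OF F] v])
    \<comment> \<open>The identity of \<open>?D\<close> is split as \<open>id \<otimes> id\<close>,
      the form to which naturality of reassociation applies.\<close>
    have "ev \<alpha> ?D v ?lhs = tensor_map K (W \<alpha>) ?D ?A ?D (\<lambda>F. F v) (tensor_map K ?B ?C ?B ?C id id) ?lhs"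
      using tensor_map_id[OF mods(5,6)]
      by (intro tensor_map_cong mods homs ev lhs) simp_all
    also have "\<dots> = tensor_assoc K ?A ?B ?C (tensor_map K (tensor_space K (W \<alpha>) ?B) ?C
      (tensor_space K ?A ?B) ?C (ev \<alpha> ?B v) id ?t)"
      by (intro tensor_assoc_natural[symmetric] mods homs ev t)
    also have "tensor_map K (tensor_space K (W \<alpha>) ?B) ?C (tensor_space K ?A ?B) ?C (ev \<alpha> ?B v) id ?t =
      tensor_map K (W (\<alpha> \<otimes> \<beta>)) ?C (tensor_space K ?A ?B) ?C (ev \<alpha> ?B v \<circ> \<Omega> \<alpha> \<beta>) (id \<circ> id)
        (\<Omega> (\<alpha> \<otimes> \<beta>) \<gamma> F)"
      by (intro tensor_map_comp mods homs evB \<Omega>F)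
    \<comment> \<open>Evaluation after \<Omega> becomes comultiplication after evaluation, an
      equality valid on the carrier of \<open>W (\<alpha> \<otimes> \<beta>)\<close>.\<close>
    also have "\<dots> = tensor_map K (W (\<alpha> \<otimes> \<beta>)) ?C (tensor_space K ?A ?B) ?C
      (\<Delta>H \<alpha> \<beta> \<circ> (\<lambda>F. F v)) (id \<circ> id) (\<Omega> (\<alpha> \<otimes> \<beta>) \<gamma> F)"
    proof (rule tensor_map_cong[OF _ _ _ _ _ _ _ _ \<Omega>F])
      show "(ev \<alpha> ?B v \<circ> \<Omega> \<alpha> \<beta>) F' = (\<Delta>H \<alpha> \<beta> \<circ> (\<lambda>F. F v)) F'"
        if "F' \<in> carrier (W (\<alpha> \<otimes> \<beta>))" for F'
        using eval_W_coaction[OF \<alpha> \<beta> that v] by simp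
      show "ev \<alpha> ?B v \<circ> \<Omega> \<alpha> \<beta> \<in> module_hom K (W (\<alpha> \<otimes> \<beta>)) (tensor_space K ?A ?B)"
        by (intro module_hom_comp[OF evB] homs)
      show "id \<circ> id \<in> module_hom K ?C ?C" by (simp add: module_hom_id)
    qed (intro mods refl)+
    also have "\<dots> = tensor_map K ?AB ?C (tensor_space K ?A ?B) ?C (\<Delta>H \<alpha> \<beta>) id
      (ev (\<alpha> \<otimes> \<beta>) ?C v (\<Omega> (\<alpha> \<otimes> \<beta>) \<gamma> F))"
      by (intro tensor_map_comp[symmetric] mods homs ev \<Omega>F)
    also have "ev (\<alpha> \<otimes> \<beta>) ?C v (\<Omega> (\<alpha> \<otimes> \<beta>) \<gamma> F) = \<Delta>H (\<alpha> \<otimes> \<beta>) \<gamma> (F v)"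
      by (rule eval_W_coaction[OF \<alpha>\<beta> \<gamma> F v])
    \<comment> \<open>Coassociativity in \<open>H\<close>; the remaining steps run the evaluation
      backwards on the other side.\<close>
    also have "tensor_assoc K ?A ?B ?C (tensor_map K ?AB ?C (tensor_space K ?A ?B) ?C (\<Delta>H \<alpha> \<beta>) id \<dots>) =
      tensor_map K ?A ?BC ?A ?D id (\<Delta>H \<beta> \<gamma>) (\<Delta>H \<alpha> (\<beta> \<otimes> \<gamma>) (F v))"
      by (rule L.hopf.coassoc[OF \<alpha> \<beta> \<gamma> Fv])
    also have "\<Delta>H \<alpha> (\<beta> \<otimes> \<gamma>) (F v) = ev \<alpha> ?BC v (\<Omega> \<alpha> (\<beta> \<otimes> \<gamma>) F)"
      by (rule eval_W_coaction[OF \<alpha> \<beta>\<gamma> F' v, symmetric])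
    also have "tensor_map K ?A ?BC ?A ?D id (\<Delta>H \<beta> \<gamma>) \<dots> =
      tensor_map K (W \<alpha>) ?BC ?A ?D (id \<circ> (\<lambda>F. F v)) (\<Delta>H \<beta> \<gamma> \<circ> id) (\<Omega> \<alpha> (\<beta> \<otimes> \<gamma>) F)"
      by (intro tensor_map_comp mods homs ev \<Omega>F')
    \<comment> \<open>Evaluation acts on the left and \<open>\<Delta>H \<beta> \<gamma>\<close> on
      the right, so either may come first.\<close>
    also have "\<dots> = tensor_map K (W \<alpha>) ?BC ?A ?D ((\<lambda>F. F v) \<circ> id) (id \<circ> \<Delta>H \<beta> \<gamma>) (\<Omega> \<alpha> (\<beta> \<otimes> \<gamma>) F)"
      by (simp only: id_o o_id)
    also have "\<dots> = ev \<alpha> ?D v ?rhs"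
      by (intro tensor_map_comp[symmetric] mods homs ev \<Omega>F')
    finally show "ev \<alpha> ?D v ?lhs = ev \<alpha> ?D v ?rhs" .
  qed
qed

text \<open>The same method with the ground space as right factor: evaluation at \<open>v\<close>
  leaves the right counit law of \<open>H\<close> at \<open>F v\<close>.\<close>

lemma W_coaction_counit:
  assumes \<alpha>: "\<alpha> \<in> carrier G" and F: "F \<in> carrier (W \<alpha>)"
  shows "tensor_map K (W \<alpha>) (H \<one>) (W \<alpha>) (ground_space K) id \<epsilon>H (\<Omega> \<alpha> \<one> F) =
    pure_tensor K (W \<alpha>) (ground_space K) F \<one>\<^bsub>K\<^esub>"
    (is "?lhs = ?rhs")
proof -
  let ?K = "ground_space K"
  have F': "F \<in> carrier (W (\<alpha> \<otimes> \<one>))" using F \<alpha> by simp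
  note mods = W_space_module[OF \<alpha>] H_module[OF \<alpha>] H_module[OF L.hopf.one_closed] ground_module
  have \<epsilon>: "\<epsilon>H \<in> module_hom K (H \<one>) ?K"
    using L.hopf.counit_linear by (simp add: linear_map_iff)
  have one: "\<one>\<^bsub>K\<^esub> \<in> carrier ?K" by (simp add: ground_space_def)
  note \<Omega>F = W_coaction_closed[OF \<alpha> L.hopf.one_closed F']
  have lhs: "?lhs \<in> carrier (tensor_space K (W \<alpha>) ?K)"
    by (intro module_hom_mem[OF tensor_map_hom] mods module_hom_id \<epsilon> \<Omega>F)
  have rhs: "?rhs \<in> carrier (tensor_space K (W \<alpha>) ?K)"
    by (intro pure_tensor_closed mods F one)
  show ?thesis
  proof (rule W_tensor_eqI[OF \<alpha> ground_module ground_space_dual_frame[OF K_cring] lhs rhs])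
    fix v assume v: "v \<in> carrier (V \<one>)"
    note ev = W_eval_hom[OF v]
    have Fv: "F v \<in> carrier (H \<alpha>)" by (rule module_hom_mem[OF W_hom[OF F] v])
    have "ev \<alpha> (H \<one>) v (\<Omega> \<alpha> \<one> F) \<in> carrier (tensor_space K (H \<alpha>) (H \<one>))"
      by (intro module_hom_mem[OF tensor_map_hom] mods module_hom_id ev \<Omega>F)
    then have \<Delta>v: "\<Delta>H \<alpha> \<one> (F v) \<in> carrier (tensor_space K (H \<alpha>) (H \<one>))"
      by (simp only: eval_W_coaction[OF \<alpha> L.hopf.one_closed F' v])
    let ?c = "tensor_map K (H \<alpha>) (H \<one>) (H \<alpha>) ?K id \<epsilon>H (\<Delta>H \<alpha> \<one> (F v))"
    have c: "?c \<in> carrier (tensor_space K (H \<alpha>) ?K)"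
      by (intro module_hom_mem[OF tensor_map_hom] mods module_hom_id \<epsilon> \<Delta>v)
    have "ev \<alpha> ?K v ?lhs =
      tensor_map K (W \<alpha>) (H \<one>) (H \<alpha>) ?K ((\<lambda>F. F v) \<circ> id) (id \<circ> \<epsilon>H) (\<Omega> \<alpha> \<one> F)"
      by (intro tensor_map_comp mods module_hom_id \<epsilon> ev \<Omega>F)
    also have "\<dots> = tensor_map K (W \<alpha>) (H \<one>) (H \<alpha>) ?K (id \<circ> (\<lambda>F. F v)) (\<epsilon>H \<circ> id) (\<Omega> \<alpha> \<one> F)"
      by (simp only: id_o o_id)
    also have "\<dots> = tensor_map K (H \<alpha>) (H \<one>) (H \<alpha>) ?K id \<epsilon>H (ev \<alpha> (H \<one>) v (\<Omega> \<alpha> \<one> F))"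
      by (intro tensor_map_comp[symmetric] mods module_hom_id \<epsilon> ev \<Omega>F)
    also have "\<dots> = ?c"
      by (simp only: eval_W_coaction[OF \<alpha> L.hopf.one_closed F' v])
    \<comment> \<open>The counit law of \<open>H\<close> speaks of the image under
      \<open>tensor_runit\<close>, so the tensor is first rewritten as that image paired with
      one.\<close>
    also have "\<dots> = pure_tensor K (H \<alpha>) ?K (tensor_runit K (H \<alpha>) ?c) \<one>\<^bsub>K\<^esub>"
      by (rule tensor_runit_inverse[OF mods(2) c, symmetric])
    also have "\<dots> = pure_tensor K (H \<alpha>) ?K (F v) \<one>\<^bsub>K\<^esub>"
      by (simp only: L.hopf.counit_right[OF \<alpha> Fv])
    also have "\<dots> = ev \<alpha> ?K v ?rhs"
      using tensor_map_pure[OF mods(1,4,2,4) ev module_hom_id F one] by simp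
    finally show "ev \<alpha> ?K v ?lhs = ev \<alpha> ?K v ?rhs" .
  qed
qed

lemma W_right_pi_comodule: "right_pi_comodule K G H \<Delta>H \<epsilon>H W \<Omega>"
proof (intro right_pi_comodule.intro right_pi_comodule_axioms.intro)
  show "pi_coalgebra K G H \<Delta>H \<epsilon>H" by unfold_locales
  \<comment> \<open>The comodule locale asks for vector spaces, so the module facts are combined
    with \<open>K_field\<close>.\<close>
  show "vectorspace K (W \<alpha>)" if "\<alpha> \<in> carrier G" for \<alpha>
    using K_field W_space_module that by (simp add: vectorspace_def)
  show "linear_map K (W (\<alpha> \<otimes> \<beta>)) (tensor_space K (W \<alpha>) (H \<beta>)) (\<Omega> \<alpha> \<beta>)"
    if "\<alpha> \<in> carrier G" "\<beta> \<in> carrier G" for \<alpha> \<beta>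
    using that K_field W_coaction_hom
    by (auto simp: linear_map_iff vectorspace_def intro!: W_space_module tensor_space_module H_module)
qed (rule W_coaction_coassoc W_coaction_counit; assumption)+

end

end

text \<open>The first conjunct certifies that the left entries in the sum defining \<Omega> belong
  to \<open>W \<alpha>\<close>, so that its pure tensors are formed in the intended tensor product.
  The bases enter the argument through their dual frames.\<close>

theorem theorem4p3:
  fixes K :: "'k ring" and G :: "'p monoid"
    and H :: "'p \<Rightarrow> ('k, 'h) module"
    and \<Delta>H :: "'p \<Rightarrow> 'p \<Rightarrow> 'h \<Rightarrow> ('k, 'h, 'h) tensor"
    and \<epsilon>H :: "'h \<Rightarrow> 'k" and S :: "'p \<Rightarrow> 'h \<Rightarrow> 'h"
    and C :: "'p \<Rightarrow> ('k, 'c) module"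
    and \<Delta>C :: "'p \<Rightarrow> 'p \<Rightarrow> 'c \<Rightarrow> ('k, 'c, 'c) tensor"
    and \<epsilon>C :: "'c \<Rightarrow> 'k"
    and \<omega> :: "'p \<Rightarrow> ('k, 'h, 'c) tensor \<Rightarrow> 'c" and \<sigma> :: "'p \<Rightarrow> 'h \<Rightarrow> 'c"
    and V :: "'p \<Rightarrow> ('k, 'v) module"
    and \<rho> :: "'p \<Rightarrow> 'p \<Rightarrow> 'v \<Rightarrow> ('k, 'c, 'v) tensor"
    and n :: "'p \<Rightarrow> nat"
    and e :: "'p \<Rightarrow> nat \<Rightarrow> 'h" and g :: "'p \<Rightarrow> nat \<Rightarrow> 'h \<Rightarrow> 'k"
  defines "W \<equiv> W_space K G H \<Delta>H C \<sigma> V \<rho>"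
    and "\<Omega> \<equiv> W_coaction K G H \<Delta>H C \<sigma> V \<rho> n e g"
  assumes hopf: "hopf_pi_coalgebra K G H \<Delta>H \<epsilon>H S"
    and fin_dim: "\<And>\<alpha>. \<alpha> \<in> carrier G \<Longrightarrow>
      vectorspace.fin_dim K (H \<alpha>) \<and> vectorspace.dim K (H \<alpha>) = n \<alpha>"
    and coisotropic: "left_coisotropic_subgroup K G H \<Delta>H \<epsilon>H S C \<Delta>C \<epsilon>C \<omega> \<sigma>"
    and comodule: "left_pi_comodule K G C \<Delta>C \<epsilon>C V \<rho>"
    and basis: "\<And>\<beta>. \<beta> \<in> carrier G \<Longrightarrow> is_basis_family K (H \<beta>) (n \<beta>) (e \<beta>)"
    and dual_basis: "\<And>\<beta>. \<beta> \<in> carrier G \<Longrightarrow>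
      is_dual_basis_family K (H \<beta>) (n \<beta>) (e \<beta>) (g \<beta>)"
  shows "(\<forall>\<alpha>\<in>carrier G. \<forall>\<beta>\<in>carrier G. \<forall>F\<in>carrier (W (\<alpha> \<otimes>\<^bsub>G\<^esub> \<beta>)). \<forall>i\<in>{1..n \<beta>}.
            W_contract K G H \<Delta>H V \<alpha> \<beta> (g \<beta> i) F \<in> carrier (W \<alpha>)) \<and>
         right_pi_comodule K G H \<Delta>H \<epsilon>H W \<Omega>"
proof -
  interpret hopf: hopf_pi_coalgebra K G H \<Delta>H \<epsilon>H S by (rule hopf)
  have frame: "dual_frame K (H \<beta>) {1..n \<beta>} (e \<beta>) (g \<beta>)" if "\<beta> \<in> carrier G" for \<beta>
    using hopf.component_space basis dual_basis that by (intro basis_dual_frame)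
  show ?thesis
    unfolding W_def \<Omega>_def
    using W_contract_closed[OF coisotropic comodule _ _ dual_frameD(3)[OF frame]]
      W_right_pi_comodule[OF coisotropic comodule frame]
    by auto
qed

end
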